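(* Let $\mathbb K$ be a definably complete structure expanding an ordered field. If $\mathbb K$ is locally o-minimal, then for every $n\in\mathbb N$ every definable subset of $\mathbb K^n$ is constructible. Therefore, $\mathbb K$ coincides with its open core (that is, every set definable in $\mathbb K$ is definable in the open core of $\mathbb K$).
   Context: Definable means definable with parameters; $\mathbb K^n$ carries the product of the order topology. A linearly ordered structure is definably complete if every definable subset of its domain has a supremum in the domain together with $\pm\infty$. $\mathbb K$ is locally o-minimal if for every definable $f:\mathbb K\to\mathbb K$ and every $x\in\mathbb K$ there is $y>x$ such that $f>0$ on $(x,y)$, or $f=0$ on $(x,y)$, or $f<0$ on $(x,y)$. A set is constructible if it is a finite Boolean combination of open sets. The open core of $\mathbb K$ is the reduct of $\mathbb K$ generated by all definable open subsets of $\mathbb K^n$, for all $n\in\mathbb N$. *)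

theory Defs
  imports "HOL-Analysis.Analysis" "HOL-Library.Extended" "HOL-Library.Lub_Glb"
begin

text \<open>First-order structures whose domain is the whole type \<open>'a\<close>. The language is given by
  sets of pairs (name, arity), so that it may contain no function symbols at all. The value of an
  interpretation on lists of the wrong length, or on names outside the language, is irrelevant,
  because well-formed formulas never refer to it.\<close>

record ('f, 'r, 'a) fo_structure =
  func_symbols :: "('f \<times> nat) set"
  rel_symbols :: "('r \<times> nat) set"
  func_interp :: "'f \<Rightarrow> 'a list \<Rightarrow> 'a"
  rel_interp :: "'r \<Rightarrow> 'a list \<Rightarrow> bool"

datatype 'f trm =
    Var nat
  | App 'f "'f trm list"

datatype ('f, 'r) fm =
    Eq "'f trm" "'f trm"
  | Rel 'r "'f trm list"
  | Neg "('f, 'r) fm"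
  | Conj "('f, 'r) fm" "('f, 'r) fm"
  | Ex nat "('f, 'r) fm"

primrec wf_trm :: "('f, 'r, 'a) fo_structure \<Rightarrow> 'f trm \<Rightarrow> bool" where
  "wf_trm M (Var i) \<longleftrightarrow> True"
| "wf_trm M (App f ts) \<longleftrightarrow> (f, length ts) \<in> func_symbols M \<and> list_all (wf_trm M) ts"

primrec wf_fm :: "('f, 'r, 'a) fo_structure \<Rightarrow> ('f, 'r) fm \<Rightarrow> bool" where
  "wf_fm M (Eq s t) \<longleftrightarrow> wf_trm M s \<and> wf_trm M t"
| "wf_fm M (Rel r ts) \<longleftrightarrow> (r, length ts) \<in> rel_symbols M \<and> list_all (wf_trm M) ts"
| "wf_fm M (Neg \<phi>) \<longleftrightarrow> wf_fm M \<phi>"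
| "wf_fm M (Conj \<phi> \<psi>) \<longleftrightarrow> wf_fm M \<phi> \<and> wf_fm M \<psi>"
| "wf_fm M (Ex i \<phi>) \<longleftrightarrow> wf_fm M \<phi>"

primrec trm_val :: "('f, 'r, 'a) fo_structure \<Rightarrow> (nat \<Rightarrow> 'a) \<Rightarrow> 'f trm \<Rightarrow> 'a" where
  "trm_val M e (Var i) = e i"
| "trm_val M e (App f ts) = func_interp M f (map (trm_val M e) ts)"

primrec sat :: "('f, 'r, 'a) fo_structure \<Rightarrow> (nat \<Rightarrow> 'a) \<Rightarrow> ('f, 'r) fm \<Rightarrow> bool" where
  "sat M e (Eq s t) \<longleftrightarrow> trm_val M e s = trm_val M e t"
| "sat M e (Rel r ts) \<longleftrightarrow> rel_interp M r (map (trm_val M e) ts)"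
| "sat M e (Neg \<phi>) \<longleftrightarrow> \<not> sat M e \<phi>"
| "sat M e (Conj \<phi> \<psi>) \<longleftrightarrow> sat M e \<phi> \<and> sat M e \<psi>"
| "sat M e (Ex i \<phi>) \<longleftrightarrow> (\<exists>a. sat M (e(i := a)) \<phi>)"

text \<open>The \<open>n\<close>-th Cartesian power of the domain is \<open>{..<n} \<rightarrow>\<^sub>E UNIV\<close>. In a formula defining a
  subset of it, the variables \<open>0, \<dots>, n - 1\<close> are the coordinates; the other free variables, which
  are finitely many, are evaluated by \<open>p\<close> and play the role of the parameters.\<close>

definition definable :: "('f, 'r, 'a) fo_structure \<Rightarrow> nat \<Rightarrow> (nat \<Rightarrow> 'a) set \<Rightarrow> bool" where
  "definable M n A \<longleftrightarrow>
     (\<exists>\<phi> p. wf_fm M \<phi> \<and>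
       A = {x \<in> {..<n} \<rightarrow>\<^sub>E UNIV. sat M (\<lambda>i. if i < n then x i else p i) \<phi>})"

definition definable_subset :: "('f, 'r, 'a) fo_structure \<Rightarrow> 'a set \<Rightarrow> bool" where
  "definable_subset M S \<longleftrightarrow> definable M 1 ({..<1} \<rightarrow>\<^sub>E S)"

definition definable_function :: "('f, 'r, 'a) fo_structure \<Rightarrow> ('a \<Rightarrow> 'a) \<Rightarrow> bool" where
  "definable_function M f \<longleftrightarrow> definable M 2 {x \<in> {..<2} \<rightarrow>\<^sub>E UNIV. x 1 = f (x 0)}"

text \<open>The constants 0 and 1, subtraction and inversion are definable from the symbols required
  here, so asking for symbols for them as well would not change the definable sets.\<close>

definition expands_ordered_field :: "('f, 'r, 'a::linordered_field) fo_structure \<Rightarrow> bool" where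
  "expands_ordered_field M \<longleftrightarrow>
     (\<exists>f. (f, 2) \<in> func_symbols M \<and> (\<forall>x y. func_interp M f [x, y] = x + y)) \<and>
     (\<exists>f. (f, 2) \<in> func_symbols M \<and> (\<forall>x y. func_interp M f [x, y] = x * y)) \<and>
     (\<exists>r. (r, 2) \<in> rel_symbols M \<and> (\<forall>x y. rel_interp M r [x, y] \<longleftrightarrow> x < y))"

text \<open>The type \<open>'a extended\<close> is \<open>'a\<close> together with \<open>Minf\<close> and \<open>Pinf\<close>.\<close>

definition definably_complete :: "('f, 'r, 'a::linorder) fo_structure \<Rightarrow> bool" where
  "definably_complete M \<longleftrightarrow>
     (\<forall>S. definable_subset M S \<longrightarrow> (\<exists>s :: 'a extended. isLub UNIV (Fin ` S) s))"

definition locally_o_minimal :: "('f, 'r, 'a::linordered_field) fo_structure \<Rightarrow> bool" where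
  "locally_o_minimal M \<longleftrightarrow>
     (\<forall>f x. definable_function M f \<longrightarrow>
       (\<exists>y>x. (\<forall>z\<in>{x<..<y}. f z > 0) \<or> (\<forall>z\<in>{x<..<y}. f z = 0) \<or> (\<forall>z\<in>{x<..<y}. f z < 0)))"

inductive constructible_in :: "'b topology \<Rightarrow> 'b set \<Rightarrow> bool" for X where
  constructible_open: "openin X U \<Longrightarrow> constructible_in X U"
| constructible_compl: "constructible_in X A \<Longrightarrow> constructible_in X (topspace X - A)"
| constructible_Un: "constructible_in X A \<Longrightarrow> constructible_in X B \<Longrightarrow> constructible_in X (A \<union> B)"
| constructible_Int: "constructible_in X A \<Longrightarrow> constructible_in X B \<Longrightarrow> constructible_in X (A \<inter> B)"

text \<open>On a \<open>linorder_topology\<close> type, \<open>euclidean\<close> is the order topology. The topspace of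
  \<open>power_topology n\<close> is \<open>{..<n} \<rightarrow>\<^sub>E UNIV\<close>.\<close>

abbreviation power_topology :: "nat \<Rightarrow> (nat \<Rightarrow> 'a::linorder_topology) topology" where
  "power_topology n \<equiv> product_topology (\<lambda>_. euclidean) {..<n}"

text \<open>The open core is purely relational: its relation symbols of arity \<open>n\<close> are the definable
  open subsets of the \<open>n\<close>-th power, each interpreted as itself.\<close>

definition open_core ::
  "('f, 'r, 'a::linorder_topology) fo_structure \<Rightarrow> ('f, (nat \<Rightarrow> 'a) set, 'a) fo_structure" where
  "open_core M =
     \<lparr> func_symbols = {},
       rel_symbols = {(U, n). definable M n U \<and> openin (power_topology n) U},
       func_interp = func_interp M,
       rel_interp = (\<lambda>U xs. (\<lambda>i\<in>{..<length xs}. xs ! i) \<in> U) \<rparr>"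

end

theory Submission
  imports Defs
begin

text \<open>Call a definable set large in a list of coordinates if it contains a box in them; by
  induction from the line, a finite union, or the union of a definable chain, of definable sets
  is large only if a member is. Choose a longest list of coordinates such that the projection of
  \<open>X\<close> is large. Over generic points of the base, the remaining coordinates take a discrete
  closed set of values on the fibre, so the fibre is closed. A set with closed fibres is
  relatively closed over the complement of a closed set of the base that is not large. Hence
  \<open>X\<close> is the union of a locally closed definable set and two definable sets whose
  projections to the chosen coordinates are no longer large, and one induces on the number of
  lists of coordinates with a large projection. This uses only definable open sets, so it also
  yields the statement on the open core.\<close>

section \<open>Definable predicates on assignments\<close>

text \<open>The domain may be non-archimedean and a definable discrete set may be infinite, so there
  are no finite coverings by intervals of given length, no countable unions and no cell
  decompositions to work with. Two definable substitutes carry the argument. A bound that varies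
  with the point (a radius, a length) is made uniform by treating it as the parameter of a chain of
  sets exhausting a large set. A value that varies with the point is trapped near a fixed
  \<open>c\<close> by an infimum, namely that of the thresholds below which values still occur over
  a large set. Together they turn the iterated quantifier into a genuine box. Closed fibres alone do
  not make a set closed, since isolation radii may shrink from fibre to fibre; the exceptional
  closed set of the base absorbs this. The induction counts lists instead of using their maximal
  length: a piece that is not large over the chosen list may be large over another list of the same
  length, so the dimension need not drop, but the count does.\<close>

primrec ren_trm :: "(nat \<Rightarrow> nat) \<Rightarrow> 'f trm \<Rightarrow> 'f trm" where
  "ren_trm \<tau> (Var i) = Var (\<tau> i)"
| "ren_trm \<tau> (App f ts) = App f (map (ren_trm \<tau>) ts)"

primrec vars_trm :: "'f trm \<Rightarrow> nat set" where
  "vars_trm (Var i) = {i}"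
| "vars_trm (App f ts) = \<Union> (set (map vars_trm ts))"

text \<open>Bound variables are included: this is a finite stock of indices that contains all free
  ones.\<close>

primrec vars_fm :: "('f, 'r) fm \<Rightarrow> nat set" where
  "vars_fm (Eq s t) = vars_trm s \<union> vars_trm t"
| "vars_fm (Rel r ts) = \<Union> (set (map vars_trm ts))"
| "vars_fm (Neg \<phi>) = vars_fm \<phi>"
| "vars_fm (Conj \<phi> \<psi>) = vars_fm \<phi> \<union> vars_fm \<psi>"
| "vars_fm (Ex i \<phi>) = insert i (vars_fm \<phi>)"

text \<open>A bound variable moves above all images under \<open>\<tau>\<close>, which prevents
  capture; \<open>insert 0\<close> provides for formulas without variables.\<close>

primrec ren_fm :: "('f, 'r) fm \<Rightarrow> (nat \<Rightarrow> nat) \<Rightarrow> ('f, 'r) fm" where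
  "ren_fm (Eq s t) \<tau> = Eq (ren_trm \<tau> s) (ren_trm \<tau> t)"
| "ren_fm (Rel r ts) \<tau> = Rel r (map (ren_trm \<tau>) ts)"
| "ren_fm (Neg \<phi>) \<tau> = Neg (ren_fm \<phi> \<tau>)"
| "ren_fm (Conj \<phi> \<psi>) \<tau> = Conj (ren_fm \<phi> \<tau>) (ren_fm \<psi> \<tau>)"
| "ren_fm (Ex i \<phi>) \<tau> =
     (let k = Suc (Max (insert 0 (\<tau> ` vars_fm \<phi>))) in Ex k (ren_fm \<phi> (\<tau>(i := k))))"

lemma finite_vars_trm: "finite (vars_trm t)"
  by (induction t) auto

lemma finite_vars_fm: "finite (vars_fm \<phi>)"
  by (induction \<phi>) (auto simp: finite_vars_trm)

lemma trm_val_cong: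
  "(\<And>i. i \<in> vars_trm t \<Longrightarrow> e i = e' i) \<Longrightarrow> trm_val M e t = trm_val M e' t"
proof (induction t)
  case (App f ts)
  then have "map (trm_val M e) ts = map (trm_val M e') ts" by (intro map_cong) auto
  then show ?case by (simp only: trm_val.simps)
qed simp

lemma sat_cong:
  "(\<And>i. i \<in> vars_fm \<phi> \<Longrightarrow> e i = e' i) \<Longrightarrow> sat M e \<phi> = sat M e' \<phi>"
proof (induction \<phi> arbitrary: e e')
  case (Eq s t)
  then show ?case using trm_val_cong[of s e e' M] trm_val_cong[of t e e' M] by simp
next
  case (Rel r ts)
  then have "map (trm_val M e) ts = map (trm_val M e') ts"
    by (intro map_cong trm_val_cong) auto
  then show ?case by (simp only: sat.simps)
next
  case (Neg \<phi>)
  then show ?case by (metis sat.simps(3) vars_fm.simps(3))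
next
  case (Conj \<phi>1 \<phi>2)
  from Conj.prems have "sat M e \<phi>1 = sat M e' \<phi>1" "sat M e \<phi>2 = sat M e' \<phi>2"
    by (auto intro!: Conj.IH)
  then show ?case by simp
next
  case (Ex i \<phi>)
  have "sat M (e(i := a)) \<phi> = sat M (e'(i := a)) \<phi>" for a
    by (rule Ex.IH) (use Ex.prems in auto)
  then show ?case by simp
qed

lemma trm_val_ren: "trm_val M e (ren_trm \<tau> t) = trm_val M (\<lambda>i. e (\<tau> i)) t"
proof (induction t)
  case (App f ts)
  then have "map (trm_val M e \<circ> ren_trm \<tau>) ts = map (trm_val M (\<lambda>i. e (\<tau> i))) ts"
    by (intro map_cong) auto
  then show ?case by (simp only: ren_trm.simps trm_val.simps map_map)
qed simp

lemma wf_trm_ren: "wf_trm M (ren_trm \<tau> t) = wf_trm M t"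
  by (induction t) (auto simp: list_all_iff)

lemma wf_fm_ren: "wf_fm M (ren_fm \<phi> \<tau>) = wf_fm M \<phi>"
  by (induction \<phi> arbitrary: \<tau>) (auto simp: list_all_iff wf_trm_ren Let_def)

lemma sat_ren: "sat M e (ren_fm \<phi> \<tau>) = sat M (\<lambda>i. e (\<tau> i)) \<phi>"
proof (induction \<phi> arbitrary: e \<tau>)
  case (Rel r ts)
  have "map (trm_val M e) (map (ren_trm \<tau>) ts) = map (trm_val M (\<lambda>i. e (\<tau> i))) ts"
    by (simp add: trm_val_ren)
  then show ?case by (simp only: sat.simps ren_fm.simps)
next
  case (Ex i \<phi>)
  define k where "k = Suc (Max (insert 0 (\<tau> ` vars_fm \<phi>)))"
  have k: "\<tau> j \<noteq> k" if "j \<in> vars_fm \<phi>" for j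
  proof -
    have "\<tau> j \<le> Max (insert 0 (\<tau> ` vars_fm \<phi>))"
      by (rule Max_ge) (use that finite_vars_fm in auto)
    then show ?thesis by (simp add: k_def)
  qed
  have "sat M (\<lambda>j. (e(k := a)) ((\<tau>(i := k)) j)) \<phi> = sat M ((\<lambda>j. e (\<tau> j))(i := a)) \<phi>" for a
    by (rule sat_cong) (use k in auto)
  then show ?case by (simp add: Let_def Ex.IH flip: k_def)
qed (auto simp: trm_val_ren)

text \<open>Each variable of the formula is read either as a coordinate of the assignment or as a
  parameter; with this slack, substitutions never change the formula.\<close>

definition definable_pred :: "('f, 'r, 'a) fo_structure \<Rightarrow> ((nat \<Rightarrow> 'a) \<Rightarrow> bool) \<Rightarrow> bool" where
  "definable_pred M P \<longleftrightarrow>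
     (\<exists>\<phi> \<rho>. wf_fm M \<phi> \<and> (\<forall>e. P e \<longleftrightarrow> sat M (\<lambda>i. case_sum e id (\<rho> i)) \<phi>))"

lemma definable_predI:
  assumes "wf_fm M \<phi>" and "\<And>e. P e \<longleftrightarrow> sat M (\<lambda>i. case_sum e id (\<rho> i)) \<phi>"
  shows "definable_pred M P"
  using assms unfolding definable_pred_def by blast

text \<open>These are the values that a reading of a single variable can produce. Sums are not among
  them and enter as relations.\<close>

definition atomic :: "((nat \<Rightarrow> 'a) \<Rightarrow> 'a) \<Rightarrow> bool" where
  "atomic f \<longleftrightarrow> (\<exists>s. \<forall>e. f e = case_sum e id s)"

lemma atomic_var: "atomic (\<lambda>e. e i)"
  unfolding atomic_def by (rule exI[of _ "Inl i"]) simp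

lemma atomic_const: "atomic (\<lambda>e. c)"
  unfolding atomic_def by (rule exI[of _ "Inr c"]) simp

lemma atomic_if: "atomic f \<Longrightarrow> atomic g \<Longrightarrow> atomic (\<lambda>e. if c then f e else g e)"
  by (cases c) auto

lemmas atomic_intros = atomic_var atomic_const atomic_if

section \<open>Closure of definable predicates under substitution, connectives and
  quantifiers\<close>

lemma dp_sub:
  assumes "definable_pred M P" and "\<And>k. atomic (\<lambda>e. g e k)"
  shows "definable_pred M (\<lambda>e. P (g e))"
proof -
  obtain \<phi> \<rho> where 1: "wf_fm M \<phi>" "\<And>e. P e \<longleftrightarrow> sat M (\<lambda>i. case_sum e id (\<rho> i)) \<phi>"
    using assms(1) unfolding definable_pred_def by auto
  have "\<forall>k. \<exists>s. \<forall>e. g e k = case_sum e id s"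
    using assms(2) unfolding atomic_def by auto
  then obtain s where s: "\<And>k e. g e k = case_sum e id (s k)" by metis
  have "case_sum (g e) id (\<rho> i) = case_sum e id (case_sum s Inr (\<rho> i))" for e i
    by (cases "\<rho> i") (auto simp: s)
  then have "P (g e) \<longleftrightarrow> sat M (\<lambda>i. case_sum e id (case_sum s Inr (\<rho> i))) \<phi>" for e
    by (simp add: 1)
  with 1(1) show ?thesis
    unfolding definable_pred_def by (intro exI[of _ \<phi>] exI[of _ "\<lambda>i. case_sum s Inr (\<rho> i)"]) simp
qed

lemma dp_not: "definable_pred M P \<Longrightarrow> definable_pred M (\<lambda>e. \<not> P e)"
  unfolding definable_pred_def by (metis sat.simps(3) wf_fm.simps(3))

lemma dp_conj:
  assumes "definable_pred M P" and "definable_pred M Q"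
  shows "definable_pred M (\<lambda>e. P e \<and> Q e)"
proof -
  obtain \<phi> \<rho> where 1: "wf_fm M \<phi>" "\<And>e. P e \<longleftrightarrow> sat M (\<lambda>i. case_sum e id (\<rho> i)) \<phi>"
    using assms(1) unfolding definable_pred_def by auto
  obtain \<psi> \<sigma> where 2: "wf_fm M \<psi>" "\<And>e. Q e \<longleftrightarrow> sat M (\<lambda>i. case_sum e id (\<sigma> i)) \<psi>"
    using assms(2) unfolding definable_pred_def by auto
  \<comment> \<open>The two formulas may read the same variable differently, so their variables are
    separated into even and odd ones.\<close>
  let ?\<theta> = "Conj (ren_fm \<phi> (\<lambda>i. 2 * i)) (ren_fm \<psi> (\<lambda>i. 2 * i + 1))"
  let ?\<rho> = "\<lambda>i. if even i then \<rho> (i div 2) else \<sigma> (i div 2)"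
  have "wf_fm M ?\<theta>" by (simp add: 1 2 wf_fm_ren)
  moreover have "P e \<and> Q e \<longleftrightarrow> sat M (\<lambda>i. case_sum e id (?\<rho> i)) ?\<theta>" for e
    by (simp add: 1 2 sat_ren)
  ultimately show ?thesis by (rule definable_predI)
qed

text \<open>The quantified element is pushed onto the front of the assignment, as with de Bruijn
  indices.\<close>

lemma dp_ex:
  assumes "definable_pred M (\<lambda>e. P (e 0) (\<lambda>i. e (Suc i)))"
  shows "definable_pred M (\<lambda>e. \<exists>a. P a e)"
proof -
  obtain \<phi> \<rho> where 1: "wf_fm M \<phi>"
    "\<And>e. P (e 0) (\<lambda>i. e (Suc i)) \<longleftrightarrow> sat M (\<lambda>i. case_sum e id (\<rho> i)) \<phi>"
    using assms unfolding definable_pred_def by auto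
  \<comment> \<open>All variables read as coordinate 0 merge into the bound variable 0. The others
    move up by one, and coordinates they read move down by one.\<close>
  let ?\<theta> = "Ex 0 (ren_fm \<phi> (\<lambda>j. if \<rho> j = Inl 0 then 0 else Suc j))"
  let ?\<rho> = "\<lambda>i. case_sum (\<lambda>k. Inl (k - 1)) Inr (\<rho> (i - 1))"
  have eq: "((\<lambda>i. case_sum e id (?\<rho> i))(0 := a)) (if \<rho> j = Inl 0 then 0 else Suc j) =
      case_sum (case_nat a e) id (\<rho> j)" for e :: "nat \<Rightarrow> _" and a j
    by (cases "\<rho> j") (auto split: nat.split)
  have "(\<exists>a. P a e) \<longleftrightarrow> sat M (\<lambda>i. case_sum e id (?\<rho> i)) ?\<theta>" for e
  proof -
    have "P a e \<longleftrightarrow> sat M (\<lambda>i. case_sum (case_nat a e) id (\<rho> i)) \<phi>" for a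
      using 1(2)[of "case_nat a e"] by simp
    then show ?thesis by (simp only: sat.simps sat_ren eq)
  qed
  with _ show ?thesis by (rule definable_predI) (simp add: 1 wf_fm_ren)
qed

lemma dp_eq:
  assumes "atomic f" and "atomic g"
  shows "definable_pred M (\<lambda>e. f e = g e)"
proof -
  obtain s t where st: "\<And>e. f e = case_sum e id s" "\<And>e. g e = case_sum e id t"
    using assms unfolding atomic_def by auto
  show ?thesis unfolding definable_pred_def
    by (rule exI[of _ "Eq (Var 0) (Var 1)"], rule exI[of _ "case_nat s (\<lambda>_. t)"]) (simp add: st)
qed

lemma dp_const: "definable_pred M (\<lambda>e. c)"
proof -
  have "definable_pred M (\<lambda>e. e 0 = e 0)" by (intro dp_eq atomic_intros)
  then show ?thesis using dp_not[of M "\<lambda>e. e 0 = e 0"] by (cases c) auto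
qed

lemma dp_disj:
  assumes "definable_pred M P" and "definable_pred M Q"
  shows "definable_pred M (\<lambda>e. P e \<or> Q e)"
  using dp_not[OF dp_conj[OF dp_not[OF assms(1)] dp_not[OF assms(2)]]] by simp

lemma dp_imp:
  assumes "definable_pred M P" and "definable_pred M Q"
  shows "definable_pred M (\<lambda>e. P e \<longrightarrow> Q e)"
  using dp_not[OF dp_conj[OF assms(1) dp_not[OF assms(2)]]] by simp

lemma dp_all:
  assumes "definable_pred M (\<lambda>e. P (e 0) (\<lambda>i. e (Suc i)))"
  shows "definable_pred M (\<lambda>e. \<forall>a. P a e)"
  using dp_not[OF dp_ex[of M "\<lambda>a e. \<not> P a e", OF dp_not[OF assms]]] by simp

lemma dp_ball:
  assumes "finite I" and "\<And>i. i \<in> I \<Longrightarrow> definable_pred M (P i)"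
  shows "definable_pred M (\<lambda>e. \<forall>i\<in>I. P i e)"
  using assms by (induction I rule: finite_induct) (auto intro: dp_const dp_conj)

lemma dp_bex:
  assumes "finite I" and "\<And>i. i \<in> I \<Longrightarrow> definable_pred M (P i)"
  shows "definable_pred M (\<lambda>e. \<exists>i\<in>I. P i e)"
  using assms by (induction I rule: finite_induct) (auto intro: dp_const dp_disj)

text \<open>As \<open>P\<close> sees only \<open>n\<close> coordinates of \<open>x\<close>,
  quantifying over assignments amounts to \<open>n\<close> element quantifiers. After
  \<open>k\<close> of them, the coordinates below \<open>k\<close> are bound and the remaining
  \<open>n - k\<close> stand at the front of \<open>e\<close>.\<close>

lemma dp_ex_vec:
  fixes P :: "(nat \<Rightarrow> 'a) \<Rightarrow> (nat \<Rightarrow> 'a) \<Rightarrow> bool"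
  assumes supp: "\<And>x y e. (\<And>i. i < n \<Longrightarrow> x i = y i) \<Longrightarrow> P x e = P y e"
    and dp: "definable_pred M (\<lambda>e. P (\<lambda>i. e i) (\<lambda>i. e (n + i)))"
  shows "definable_pred M (\<lambda>e. \<exists>x. P x e)"
proof -
  have "definable_pred M (\<lambda>e. \<exists>x. P (\<lambda>i. if i < k then x i else e (i - k)) (\<lambda>i. e (n - k + i)))"
    if "k \<le> n" for k
    using that
  proof (induction k)
    case 0
    then show ?case using dp by simp
  next
    case (Suc k)
    define R where "R = (\<lambda>e. \<exists>x. P (\<lambda>i. if i < k then x i else e (i - k)) (\<lambda>i. e (n - k + i)))"
    have "definable_pred M (\<lambda>e. \<exists>a. R (case_nat a e))"
    proof (rule dp_ex, rule dp_sub[of M R])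
      show "definable_pred M R" using Suc unfolding R_def by simp
      show "atomic (\<lambda>e. case_nat (e 0) (\<lambda>i. e (Suc i)) k)" for k
        by (cases k) (auto intro: atomic_intros)
    qed
    also have "(\<lambda>e. \<exists>a. R (case_nat a e)) =
       (\<lambda>e. \<exists>x. P (\<lambda>i. if i < Suc k then x i else e (i - Suc k)) (\<lambda>i. e (n - Suc k + i)))"
    proof
      fix e :: "nat \<Rightarrow> 'a"
      have shift: "(\<lambda>i. case_nat a e (n - k + i)) = (\<lambda>i. e (n - Suc k + i))" for a
      proof
        fix i
        have "n - k + i = Suc (n - Suc k + i)" using Suc.prems by simp
        then show "case_nat a e (n - k + i) = e (n - Suc k + i)" by (simp only: nat.case)
      qed
      have upd: "(\<lambda>i. if i < k then x i else case_nat a e (i - k)) =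
          (\<lambda>i. if i < Suc k then (x(k := a)) i else e (i - Suc k))" for x a
        by (auto simp: fun_eq_iff split: nat.split)
          (metis add.commute diff_Suc_1 diff_diff_left plus_1_eq_Suc)
      show "(\<exists>a. R (case_nat a e)) =
        (\<exists>x. P (\<lambda>i. if i < Suc k then x i else e (i - Suc k)) (\<lambda>i. e (n - Suc k + i)))"
        (is "?L = ?R")
      proof
        assume ?L
        then obtain a x where "P (\<lambda>i. if i < k then x i else case_nat a e (i - k))
            (\<lambda>i. case_nat a e (n - k + i))" unfolding R_def by auto
        then show ?R unfolding shift upd by (rule exI[of _ "x(k := a)"])
      next
        assume ?R
        then obtain x where x: "P (\<lambda>i. if i < Suc k then x i else e (i - Suc k))
            (\<lambda>i. e (n - Suc k + i))" ..
        have "R (case_nat (x k) e)"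
          unfolding R_def shift upd by (rule exI[of _ x]) (use x in \<open>simp only: fun_upd_triv\<close>)
        then show ?L ..
      qed
    qed
    finally show ?case .
  qed
  from this[of n] have "definable_pred M (\<lambda>e. \<exists>x. P (\<lambda>i. if i < n then x i else e (i - n)) e)"
    by simp
  also have "(\<lambda>e. \<exists>x. P (\<lambda>i. if i < n then x i else e (i - n)) e) = (\<lambda>e. \<exists>x. P x e)"
  proof
    fix e
    have "P (\<lambda>i. if i < n then x i else e (i - n)) e = P x e" for x by (rule supp) simp
    then show "(\<exists>x. P (\<lambda>i. if i < n then x i else e (i - n)) e) = (\<exists>x. P x e)" by simp
  qed
  finally show ?thesis .
qed

section \<open>Passage between definable sets and definable predicates\<close>

lemma definable_iff:
  "definable M n A \<longleftrightarrow>
     A \<subseteq> {..<n} \<rightarrow>\<^sub>E UNIV \<and> definable_pred M (\<lambda>e. restrict e {..<n} \<in> A)"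
proof
  assume "definable M n A"
  then obtain \<phi> p where 1: "wf_fm M \<phi>"
    "A = {x \<in> {..<n} \<rightarrow>\<^sub>E UNIV. sat M (\<lambda>i. if i < n then x i else p i) \<phi>}"
    unfolding definable_def by auto
  have "restrict e {..<n} \<in> A \<longleftrightarrow>
      sat M (\<lambda>i. case_sum e id (if i < n then Inl i else Inr (p i))) \<phi>" for e
  proof -
    have "(\<lambda>i. if i < n then restrict e {..<n} i else p i) =
        (\<lambda>i. case_sum e id (if i < n then Inl i else Inr (p i)))" by auto
    then show ?thesis unfolding 1 by simp
  qed
  then have "definable_pred M (\<lambda>e. restrict e {..<n} \<in> A)"
    unfolding definable_pred_def using 1(1)
    by (intro exI[of _ \<phi>] exI[of _ "\<lambda>i. if i < n then Inl i else Inr (p i)"]) simp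
  then show "A \<subseteq> {..<n} \<rightarrow>\<^sub>E UNIV \<and> definable_pred M (\<lambda>e. restrict e {..<n} \<in> A)"
    using 1 by auto
next
  assume A: "A \<subseteq> {..<n} \<rightarrow>\<^sub>E UNIV \<and> definable_pred M (\<lambda>e. restrict e {..<n} \<in> A)"
  then obtain \<phi> \<rho> where 1: "wf_fm M \<phi>"
    "\<And>e. restrict e {..<n} \<in> A \<longleftrightarrow> sat M (\<lambda>i. case_sum e id (\<rho> i)) \<phi>"
    unfolding definable_pred_def by auto
  \<comment> \<open>Coordinates from \<open>n\<close> on are hidden by \<open>restrict\<close> and
    share the variable \<open>n\<close>; parameters receive the variables from \<open>n + 1\<close>
    on.\<close>
  define \<tau> where "\<tau> j = case_sum (\<lambda>k. min k n) (\<lambda>b. n + 1 + j) (\<rho> j)" for j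
  define p where "p i = case_sum (\<lambda>k. undefined) id (\<rho> (i - (n + 1)))" for i
  have "x \<in> A \<longleftrightarrow> sat M (\<lambda>i. if i < n then x i else p i) (ren_fm \<phi> \<tau>)"
    if x: "x \<in> {..<n} \<rightarrow>\<^sub>E UNIV" for x
  proof -
    define x' where "x' k = (if k < n then x k else p n)" for k
    have "restrict x' {..<n} = x"
      using x by (auto simp: x'_def fun_eq_iff PiE_def extensional_def)
    then have "x \<in> A \<longleftrightarrow> sat M (\<lambda>i. case_sum x' id (\<rho> i)) \<phi>" using 1(2)[of x'] by simp
    also have "(\<lambda>i. case_sum x' id (\<rho> i)) = (\<lambda>j. if \<tau> j < n then x (\<tau> j) else p (\<tau> j))"
    proof
      fix j
      show "case_sum x' id (\<rho> j) = (if \<tau> j < n then x (\<tau> j) else p (\<tau> j))"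
        by (cases "\<rho> j") (auto simp: \<tau>_def p_def x'_def min_def)
    qed
    finally show ?thesis by (simp add: sat_ren)
  qed
  then have "A = {x \<in> {..<n} \<rightarrow>\<^sub>E UNIV. sat M (\<lambda>i. if i < n then x i else p i) (ren_fm \<phi> \<tau>)}"
    using A by auto
  then show "definable M n A" unfolding definable_def using 1(1)
    by (intro exI[of _ "ren_fm \<phi> \<tau>"] exI[of _ p]) (simp add: wf_fm_ren)
qed


lemma dp_app1:
  assumes "definable_pred M (\<lambda>e. Q (e 0))" and "atomic f"
  shows "definable_pred M (\<lambda>e. Q (f e))"
  by (rule dp_sub[OF assms(1), of "\<lambda>e i. f e"]) (rule assms(2))

lemma dp_app2:
  assumes "definable_pred M (\<lambda>e. Q (e 0) (e 1))" and "atomic f" and "atomic g"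
  shows "definable_pred M (\<lambda>e. Q (f e) (g e))"
  using dp_sub[OF assms(1), of "\<lambda>e i. if i = 0 then f e else g e"] assms(2,3)
  by (simp add: atomic_if)

lemma dp_app_env:
  assumes "definable_pred M (\<lambda>e. Q (e 0) (\<lambda>i. e (Suc i)))"
    and "atomic f" and "\<And>k. atomic (\<lambda>e. g e k)"
  shows "definable_pred M (\<lambda>e. Q (f e) (g e))"
  using dp_sub[OF assms(1), of "\<lambda>e i. if i = 0 then f e else g e (i - 1)"] assms(2,3)
  by (simp add: atomic_if)

lemma dp_app_vec:
  assumes supp: "\<And>x y e. (\<And>i. i < n \<Longrightarrow> x i = y i) \<Longrightarrow> Q x e = Q y e"
    and dp: "definable_pred M (\<lambda>e. Q (\<lambda>i. e i) (\<lambda>i. e (n + i)))"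
    and "\<And>k. atomic (\<lambda>e. f e k)" and "\<And>k. atomic (\<lambda>e. g e k)"
  shows "definable_pred M (\<lambda>e. Q (f e) (g e))"
proof -
  have "definable_pred M
      (\<lambda>e. Q (\<lambda>i. if i < n then f e i else g e (i - n)) (\<lambda>i. if n + i < n then f e (n + i) else g e (n + i - n)))"
    by (rule dp_sub[OF dp, of "\<lambda>e i. if i < n then f e i else g e (i - n)"])
      (intro atomic_if assms(3,4))
  moreover have "Q (\<lambda>i. if i < n then f e i else g e (i - n)) y = Q (f e) y" for e y
    by (rule supp) simp
  ultimately show ?thesis by simp
qed

lemma atomic_upd:
  "atomic (\<lambda>e. g e k) \<Longrightarrow> atomic f \<Longrightarrow> atomic (\<lambda>e. ((g e)(j := f e)) k)"
  by (cases "k = j") auto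

section \<open>Intervals on the line and largeness in several coordinates\<close>

definition has_ivl :: "('a::linorder \<Rightarrow> bool) \<Rightarrow> bool" where
  "has_ivl Q \<longleftrightarrow> (\<exists>a b. a < b \<and> (\<forall>x. a < x \<and> x < b \<longrightarrow> Q x))"

text \<open>Being large means containing a box in the listed coordinates. Defining it as an iterated
  quantifier reduces the ideal property and the category property below to the line.\<close>

primrec large :: "nat list \<Rightarrow> ((nat \<Rightarrow> 'a::linorder) \<Rightarrow> bool) \<Rightarrow> (nat \<Rightarrow> 'a) \<Rightarrow> bool" where
  "large [] P e \<longleftrightarrow> P e"
| "large (i # is) P e \<longleftrightarrow> has_ivl (\<lambda>a. large is P (e(i := a)))"

lemma has_ivl_mono: "has_ivl P \<Longrightarrow> (\<And>x. P x \<Longrightarrow> Q x) \<Longrightarrow> has_ivl Q"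
  unfolding has_ivl_def by blast

lemma not_has_ivl_False: "\<not> has_ivl (\<lambda>x :: 'a :: {linorder, dense_order}. False)"
  unfolding has_ivl_def using dense by blast

lemma large_mono: "large is P e \<Longrightarrow> (\<And>e. P e \<Longrightarrow> Q e) \<Longrightarrow> large is Q e"
proof (induction "is" arbitrary: e)
  case (Cons i "is")
  then show ?case by (auto elim!: has_ivl_mono)
qed simp

lemma not_large_False: "\<not> large is (\<lambda>e :: nat \<Rightarrow> 'a :: {linorder, dense_order}. False) e"
proof (induction "is" arbitrary: e)
  case (Cons i "is")
  then show ?case using not_has_ivl_False by simp
qed simp

locale definably_complete_lom =
  fixes M :: "('f, 'r, 'a::linordered_field) fo_structure"
  assumes expands: "expands_ordered_field M"
    and complete: "definably_complete M"
    and lom: "locally_o_minimal M"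
begin

text \<open>Addition is expressed by its graph because \<open>atomic\<close> admits no sums.\<close>

lemma dp_add_eq:
  assumes "atomic f" and "atomic g" and "atomic h"
  shows "definable_pred M (\<lambda>e. f e + g e = h e)"
proof -
  obtain s t u where stu: "\<And>e. f e = case_sum e id s" "\<And>e. g e = case_sum e id t"
      "\<And>e. h e = case_sum e id u"
    using assms unfolding atomic_def by metis
  obtain p where p: "(p, 2) \<in> func_symbols M" "\<And>x y. func_interp M p [x, y] = x + y"
    using expands unfolding expands_ordered_field_def by auto
  show ?thesis
    by (rule definable_predI[of M "Eq (App p [Var 0, Var 1]) (Var 2)" _
          "\<lambda>i. if i = 0 then s else if i = 1 then t else u"]) (use p in \<open>auto simp: stu numeral_2_eq_2\<close>)
qed

lemma dp_less:
  assumes "atomic f" and "atomic g"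
  shows "definable_pred M (\<lambda>e. f e < g e)"
proof -
  obtain s t where st: "\<And>e. f e = case_sum e id s" "\<And>e. g e = case_sum e id t"
    using assms unfolding atomic_def by metis
  obtain r where r: "(r, 2) \<in> rel_symbols M" "\<And>x y. rel_interp M r [x, y] \<longleftrightarrow> x < y"
    using expands unfolding expands_ordered_field_def by auto
  show ?thesis
    by (rule definable_predI[of M "Rel r [Var 0, Var 1]" _ "\<lambda>i. if i = 0 then s else t"])
      (use r in \<open>auto simp: st numeral_2_eq_2\<close>)
qed

lemma dp_le: "atomic f \<Longrightarrow> atomic g \<Longrightarrow> definable_pred M (\<lambda>e. f e \<le> g e)"
  using dp_not[OF dp_less[of g f]] by (simp add: not_less)

lemma atomic_shift: "atomic f \<Longrightarrow> atomic (\<lambda>e. f (\<lambda>i. e (Suc i)))"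
  unfolding atomic_def
proof (elim exE)
  fix s :: "nat + 'b" assume s: "\<forall>e. f e = case_sum e id s"
  show "\<exists>t. \<forall>e. f (\<lambda>i. e (Suc i)) = case_sum e id t"
    by (rule exI[of _ "case_sum (\<lambda>i. Inl (Suc i)) Inr s"]) (cases s; simp add: s)
qed

lemma dp_less_add:
  assumes "atomic f" and "atomic g" and "atomic h"
  shows "definable_pred M (\<lambda>e. f e < g e + h e)"
proof -
  have "definable_pred M (\<lambda>e. \<exists>a. g e + h e = a \<and> f e < a)"
    by (intro dp_ex dp_conj dp_add_eq dp_less atomic_intros atomic_shift assms)
  then show ?thesis by simp
qed

lemma dp_has_ivl:
  assumes "definable_pred M (\<lambda>e. Q (e 0) (\<lambda>i. e (Suc i)))"
  shows "definable_pred M (\<lambda>e. has_ivl (\<lambda>x. Q x e))"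
  unfolding has_ivl_def
  by (intro dp_ex dp_conj dp_less dp_all dp_imp dp_app_env[of M Q, OF assms] atomic_intros)

lemmas dp_intros = dp_ex dp_all dp_conj dp_disj dp_imp dp_not dp_less dp_le dp_less_add dp_add_eq
  dp_eq dp_const dp_has_ivl atomic_var atomic_const atomic_upd

lemma dp_large:
  assumes "definable_pred M P"
  shows "definable_pred M (large is P)"
proof (induction "is")
  case (Cons i "is")
  show ?case by (simp, intro dp_has_ivl dp_sub[OF Cons.IH] atomic_upd atomic_intros)
qed (simp add: assms)

text \<open>The chain and pigeonhole arguments need definability jointly in the parameter, kept at
  index 0, and the point.\<close>

lemma dp_large_family:
  assumes "definable_pred M (\<lambda>e. T (e 0) (\<lambda>i. e (Suc i)))"
  shows "definable_pred M (\<lambda>e. large is (T (e 0)) (\<lambda>i. e (Suc i)))"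
proof (induction "is")
  case (Cons i "is")
  show ?case
    by (simp, intro dp_has_ivl dp_app_env[of M "\<lambda>t. large is (T t)", OF Cons.IH] atomic_upd atomic_intros)
qed (simp add: assms)

section \<open>Definable subsets of the line\<close>

text \<open>Local o-minimality is applied to the indicator function of \<open>Q\<close>.\<close>

lemma germ_right:
  assumes Q: "definable_pred M (\<lambda>e. Q (e 0))"
  shows "\<exists>y>x. (\<forall>z. x < z \<and> z < y \<longrightarrow> Q z) \<or> (\<forall>z. x < z \<and> z < y \<longrightarrow> \<not> Q z)"
proof -
  let ?f = "\<lambda>z. if Q z then 1 else 0 :: 'a"
  have "definable_pred M (\<lambda>e. (Q (e 0) \<and> e 1 = 1) \<or> (\<not> Q (e 0) \<and> e 1 = 0))"
    by (intro dp_intros dp_app1[OF Q])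
  also have "(\<lambda>e :: nat \<Rightarrow> 'a. (Q (e 0) \<and> e 1 = 1) \<or> (\<not> Q (e 0) \<and> e 1 = 0)) =
      (\<lambda>e. restrict e {..<2} \<in> {x \<in> {..<2} \<rightarrow>\<^sub>E UNIV. x 1 = ?f (x 0)})"
    by (auto simp: fun_eq_iff)
  finally have "definable_function M ?f"
    unfolding definable_function_def definable_iff by auto
  then obtain y where y: "y > x"
      "(\<forall>z\<in>{x<..<y}. ?f z > 0) \<or> (\<forall>z\<in>{x<..<y}. ?f z = 0) \<or> (\<forall>z\<in>{x<..<y}. ?f z < 0)"
    using lom[unfolded locally_o_minimal_def, rule_format, of ?f x] by blast
  have f: "?f z < 0 \<longleftrightarrow> False" "?f z > 0 \<longleftrightarrow> Q z" "?f z = 0 \<longleftrightarrow> \<not> Q z" for z by auto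
  \<comment> \<open>A point of the interval is needed to exclude the third alternative, that the
    indicator is negative throughout.\<close>
  obtain w where "w \<in> {x<..<y}" using dense[OF y(1)] by auto
  with y show ?thesis unfolding f by (intro exI[of _ y]) auto
qed

text \<open>Reflection reduces this to \<open>germ_right\<close>; negation is definable through
  \<open>e 0 + b = 0\<close>.\<close>

lemma germ_left:
  assumes Q: "definable_pred M (\<lambda>e. Q (e 0))"
  shows "\<exists>y<x. (\<forall>z. y < z \<and> z < x \<longrightarrow> Q z) \<or> (\<forall>z. y < z \<and> z < x \<longrightarrow> \<not> Q z)"
proof -
  have "definable_pred M (\<lambda>e. \<exists>b. e 0 + b = 0 \<and> Q b)"
    by (intro dp_intros dp_app1[OF Q])
  also have "(\<lambda>e. \<exists>b. e 0 + b = 0 \<and> Q b) = (\<lambda>e. Q (- e 0))"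
    by (auto simp: fun_eq_iff add_eq_0_iff)
  finally obtain y where y: "y > - x"
    "(\<forall>z. - x < z \<and> z < y \<longrightarrow> Q (- z)) \<or> (\<forall>z. - x < z \<and> z < y \<longrightarrow> \<not> Q (- z))"
    using germ_right[of "\<lambda>z. Q (- z)" "- x"] by auto
  have "- x < - z \<and> - z < y" if "- y < z" "z < x" for z using that by auto
  with y show ?thesis by (intro exI[of _ "- y"]) (metis minus_minus minus_less_iff)
qed

text \<open>Both one-sided germs at \<open>x\<close> must avoid \<open>Q\<close>. Since
  \<open>x\<close> itself may lie outside \<open>Q\<close>, this yields discreteness and closedness
  at once.\<close>

lemma isolated:
  assumes Q: "definable_pred M (\<lambda>e. Q (e 0))" and "\<not> has_ivl Q"
  shows "\<exists>\<epsilon>>0. \<forall>z. Q z \<and> z < x + \<epsilon> \<and> x < z + \<epsilon> \<longrightarrow> z = x"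
proof -
  obtain y where y: "y > x" "\<forall>z. x < z \<and> z < y \<longrightarrow> \<not> Q z"
    using germ_right[OF Q, of x] assms(2) unfolding has_ivl_def by blast
  obtain y' where y': "y' < x" "\<forall>z. y' < z \<and> z < x \<longrightarrow> \<not> Q z"
    using germ_left[OF Q, of x] assms(2) unfolding has_ivl_def by blast
  have "z = x" if "Q z" "z < x + min (y - x) (x - y')" "x < z + min (y - x) (x - y')" for z
  proof -
    have "z < y" "y' < z" using that by auto
    with y y' that(1) show ?thesis by (metis linorder_less_linear)
  qed
  then show ?thesis using y y' by (intro exI[of _ "min (y - x) (x - y')"]) auto
qed

text \<open>The germ of \<open>Q\<close> at the left end of the interval decides: if
  \<open>Q\<close> fails just to the right of it, then \<open>R\<close> holds there.\<close>

lemma has_ivl_disj: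
  assumes Q: "definable_pred M (\<lambda>e. Q (e 0))"
    and "has_ivl (\<lambda>x. Q x \<or> R x)"
  shows "has_ivl Q \<or> has_ivl R"
proof -
  obtain a b where ab: "a < b" "\<And>x. a < x \<Longrightarrow> x < b \<Longrightarrow> Q x \<or> R x"
    using assms(2) unfolding has_ivl_def by auto
  obtain y where y: "y > a" "(\<forall>z. a < z \<and> z < y \<longrightarrow> Q z) \<or> (\<forall>z. a < z \<and> z < y \<longrightarrow> \<not> Q z)"
    using germ_right[OF Q] by blast
  have "a < min y b" using ab y by auto
  from y(2) show ?thesis
  proof
    assume "\<forall>z. a < z \<and> z < y \<longrightarrow> \<not> Q z"
    then have "\<forall>z. a < z \<and> z < min y b \<longrightarrow> R z" using ab by auto
    then show ?thesis unfolding has_ivl_def using \<open>a < min y b\<close> by blast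
  qed (use y has_ivl_def in blast)
qed

text \<open>Completeness provides suprema, so it is applied to the set of lower bounds;
  \<open>B\<close> rules out \<open>Minf\<close> and \<open>x0\<close> rules out
  \<open>Pinf\<close>.\<close>

lemma inf_exists:
  assumes Q: "definable_pred M (\<lambda>e. Q (e 0))" and "Q x0" and "\<And>x. Q x \<Longrightarrow> B \<le> x"
  shows "\<exists>s. (\<forall>x. Q x \<longrightarrow> s \<le> x) \<and> (\<forall>u. (\<forall>x. Q x \<longrightarrow> u \<le> x) \<longrightarrow> u \<le> s)"
proof -
  let ?L = "{u. \<forall>x. Q x \<longrightarrow> u \<le> x}"
  have "definable_pred M (\<lambda>e. \<forall>x. Q x \<longrightarrow> e 0 \<le> x)"
    by (intro dp_intros dp_app1[OF Q])
  also have "(\<lambda>e :: nat \<Rightarrow> 'a. \<forall>x. Q x \<longrightarrow> e 0 \<le> x) =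
      (\<lambda>e. restrict e {..<1} \<in> {..<1} \<rightarrow>\<^sub>E ?L)"
    by (auto simp: fun_eq_iff PiE_iff)
  finally have "definable_subset M ?L"
    unfolding definable_subset_def definable_iff by (auto simp: PiE_iff)
  then obtain l :: "'a extended" where l: "isLub UNIV (Fin ` ?L) l"
    using complete unfolding definably_complete_def by blast
  have le: "Fin u \<le> l" if "u \<in> ?L" for u
    using l that unfolding isLub_def leastP_def isUb_def setle_def by auto
  have least: "l \<le> Fin v" if "\<And>u. u \<in> ?L \<Longrightarrow> u \<le> v" for v
    using l that unfolding isLub_def leastP_def isUb_def setle_def setge_def by auto
  have "B \<in> ?L" using assms(3) by auto
  from le[OF this] have "l \<noteq> Minf" by auto
  moreover have "l \<le> Fin x0" using assms(2) by (intro least) auto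
  then have "l \<noteq> Pinf" by auto
  ultimately obtain s where s: "l = Fin s" by (cases l) auto
  show ?thesis
  proof (intro exI[of _ s] conjI allI impI)
    fix x assume "Q x"
    then have "l \<le> Fin x" by (intro least) auto
    then show "s \<le> x" by (simp add: s)
  next
    fix u assume "\<forall>x. Q x \<longrightarrow> u \<le> x"
    then show "u \<le> s" using le[of u] by (simp add: s)
  qed
qed

text \<open>By \<open>isolated\<close>, other points of \<open>Q\<close> cannot approach the
  infimum, so it is attained.\<close>

lemma min_exists:
  assumes Q: "definable_pred M (\<lambda>e. Q (e 0))" and "\<not> has_ivl Q"
    and "Q x0" and "\<And>x. Q x \<Longrightarrow> B \<le> x"
  shows "\<exists>m. Q m \<and> (\<forall>x. Q x \<longrightarrow> m \<le> x)"
proof -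
  obtain s where s: "\<And>x. Q x \<Longrightarrow> s \<le> x" "\<And>u. (\<And>x. Q x \<Longrightarrow> u \<le> x) \<Longrightarrow> u \<le> s"
    using inf_exists[OF Q assms(3,4)] by blast
  obtain \<epsilon> where \<epsilon>: "\<epsilon> > 0" "\<And>z. Q z \<Longrightarrow> z < s + \<epsilon> \<Longrightarrow> s < z + \<epsilon> \<Longrightarrow> z = s"
    using isolated[OF Q assms(2)] by blast
  have "\<not> s + \<epsilon> \<le> s" using \<epsilon> by simp
  then obtain x where x: "Q x" "x < s + \<epsilon>" using s(2)[of "s + \<epsilon>"] not_less by blast
  have "s < x + \<epsilon>" using s(1)[OF x(1)] \<epsilon>(1) by linarith
  with \<epsilon> x have "x = s" by blast
  with x s show ?thesis by blast
qed

text \<open>Otherwise let \<open>Y\<close> be the set of points that enter the chain earlier than all points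
  between \<open>a\<close> and them. The minima of the discrete members of the chain show that \<open>Y\<close>
  accumulates at \<open>a\<close>, so it contains an interval, on which points enter the later the
  closer they are to \<open>a\<close>; hence a member containing one of these points contains all larger ones.\<close>

lemma chain_has_ivl:
  assumes T: "definable_pred M (\<lambda>e. T (e 0) (e 1))"
    and chain: "\<And>t t'. (\<forall>x. T t x \<longrightarrow> T t' x) \<or> (\<forall>x. T t' x \<longrightarrow> T t x)"
    and union: "has_ivl (\<lambda>x. \<exists>t. T t x)"
  shows "\<exists>t. has_ivl (T t)"
proof (rule ccontr)
  assume no: "\<nexists>t. has_ivl (T t)"
  obtain a b where ab: "a < b" "\<And>x. a < x \<Longrightarrow> x < b \<Longrightarrow> \<exists>t. T t x"
    using union unfolding has_ivl_def by auto
  define Y where "Y y \<longleftrightarrow> (\<forall>z. a < z \<and> z < y \<longrightarrow> (\<exists>t. T t y \<and> \<not> T t z))" for y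
  have Y: "definable_pred M (\<lambda>e. Y (e 0))"
    unfolding Y_def by (intro dp_intros dp_app2[OF T])
  have acc: "\<exists>m. a < m \<and> m < d \<and> Y m" if ad: "a < d" for d
  proof -
    obtain c where c: "a < c" "c < min b d" using dense[of a "min b d"] ab ad by auto
    then obtain t where t: "T t c" using ab by auto
    have "\<exists>m. (T t m \<and> a < m) \<and> (\<forall>x. T t x \<and> a < x \<longrightarrow> m \<le> x)"
    proof (rule min_exists[where B = a])
      show "definable_pred M (\<lambda>e. T t (e 0) \<and> a < e 0)" by (intro dp_intros dp_app2[OF T])
      show "\<not> has_ivl (\<lambda>x. T t x \<and> a < x)" using no has_ivl_mono by blast
    qed (use t c in auto)
    then obtain m where m: "T t m" "a < m" "\<And>x. T t x \<Longrightarrow> a < x \<Longrightarrow> m \<le> x" by auto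
    have "m \<le> c" using m t c by auto
    \<comment> \<open>The witness is \<open>t\<close> itself: \<open>T t\<close> contains
      \<open>m\<close> and nothing between \<open>a\<close> and \<open>m\<close>.\<close>
    moreover have "Y m" unfolding Y_def using m by (metis not_less)
    ultimately show ?thesis using m c by (intro exI[of _ m]) auto
  qed
  obtain d where d: "a < d" "\<And>y. a < y \<Longrightarrow> y < d \<Longrightarrow> Y y"
    using germ_right[OF Y, of a] acc by blast
  obtain w where w: "a < w" "w < min b d" using dense[of a "min b d"] ab d by auto
  then obtain t where t: "T t w" using ab by auto
  have "T t y" if y: "w < y" "y < d" for y
  proof -
    have "Y y" using d w y by auto
    then obtain t' where "T t' y" "\<not> T t' w" using w y unfolding Y_def by blast
    with chain[of t t'] t show ?thesis by blast
  qed
  then have "has_ivl (T t)" unfolding has_ivl_def using w by (intro exI[of _ w] exI[of _ d]) auto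
  with no show False by blast
qed

section \<open>Large definable sets\<close>

lemma large_disj:
  assumes P: "definable_pred M P"
  shows "large is (\<lambda>e. P e \<or> Q e) e \<Longrightarrow> large is P e \<or> large is Q e"
proof (induction "is" arbitrary: e)
  case (Cons i "is")
  have "has_ivl (\<lambda>a. large is P (e(i := a)) \<or> large is Q (e(i := a)))"
    using Cons by (auto elim!: has_ivl_mono)
  moreover have "definable_pred M (\<lambda>e'. large is P (e(i := e' 0)))"
    by (intro dp_sub[OF dp_large[OF P]] dp_intros)
  ultimately show ?case by (simp add: has_ivl_disj)
qed simp

lemma large_bex:
  assumes "finite J" and "\<And>j. j \<in> J \<Longrightarrow> definable_pred M (P j)"
    and "large is (\<lambda>e. \<exists>j\<in>J. P j e) e"
  shows "\<exists>j\<in>J. large is (P j) e"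
  using assms
proof (induction J rule: finite_induct)
  case empty
  then show ?case using not_large_False[of "is" e] by simp
next
  case (insert j J)
  have "large is (P j) e \<or> large is (\<lambda>e. \<exists>j\<in>J. P j e) e"
    using insert.prems by (intro large_disj) auto
  with insert show ?case by auto
qed

text \<open>The induction hypothesis gives a \<open>t\<close> for each value of the first
  coordinate. By monotonicity the sets of values that work for a given \<open>t\<close> again form a
  chain, so \<open>chain_has_ivl\<close> finds one \<open>t\<close> for an interval of
  values.\<close>

lemma large_chain:
  assumes T: "definable_pred M (\<lambda>e. T (e 0) (\<lambda>i. e (Suc i)))"
    and chain: "\<And>t t'. (\<forall>e. T t e \<longrightarrow> T t' e) \<or> (\<forall>e. T t' e \<longrightarrow> T t e)"
  shows "large is (\<lambda>e. \<exists>t. T t e) e \<Longrightarrow> \<exists>t. large is (T t) e"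
proof (induction "is" arbitrary: e)
  case (Cons i "is")
  have "\<exists>t. has_ivl (\<lambda>a. large is (T t) (e(i := a)))"
  proof (rule chain_has_ivl)
    show "definable_pred M (\<lambda>e'. large is (T (e' 0)) (e(i := e' 1)))"
      by (intro dp_app_env[of M "\<lambda>t. large is (T t)", OF dp_large_family[OF T]] dp_intros)
    show "(\<forall>x. large is (T t) (e(i := x)) \<longrightarrow> large is (T t') (e(i := x))) \<or>
        (\<forall>x. large is (T t') (e(i := x)) \<longrightarrow> large is (T t) (e(i := x)))" for t t'
      using chain[of t t'] large_mono by blast
    show "has_ivl (\<lambda>x. \<exists>t. large is (T t) (e(i := x)))"
      using Cons by (auto elim!: has_ivl_mono)
  qed
  then show ?case by simp
qed simp

text \<open>Values chosen over a large set can be confined to one window of prescribed radius. The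
  window sits at the infimum \<open>s\<close> of the thresholds \<open>c\<close> for which
  \<open>U c\<close> is large.\<close>

lemma pigeonhole:
  assumes Q: "definable_pred M (\<lambda>e. Q (e 0) (\<lambda>i. e (Suc i)))"
    and large: "large is (\<lambda>e. \<exists>a. Q a e) e" and "0 < \<delta>"
  shows "\<exists>c. large is (\<lambda>e. \<exists>a. a < c + \<delta> \<and> c < a + \<delta> \<and> Q a e) e"
proof -
  \<comment> \<open>First the size of the values is bounded: these sets increase with
    \<open>r\<close> and exhaust the given one.\<close>
  define T where "T r e \<longleftrightarrow> (\<exists>a. a < r \<and> 0 < a + r \<and> Q a e)" for r e
  have "\<exists>r. large is (T r) e"
  proof (rule large_chain)
    show "definable_pred M (\<lambda>e. T (e 0) (\<lambda>i. e (Suc i)))"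
      unfolding T_def by (intro dp_app_env[OF Q] dp_intros)
    have mono: "T r e \<Longrightarrow> T r' e" if "r \<le> r'" for r r' e
      unfolding T_def using that by (meson add_left_mono less_le_trans)
    show "(\<forall>e. T t e \<longrightarrow> T t' e) \<or> (\<forall>e. T t' e \<longrightarrow> T t e)" for t t'
      using mono linear[of t t'] by blast
    have "\<exists>r. T r e" if "Q a e" for a e
      unfolding T_def using that
      by (intro exI[of _ "\<bar>a\<bar> + 1"] exI[of _ a]) (auto simp: abs_if)
    then show "large is (\<lambda>e. \<exists>t. T t e) e" using large by (auto elim!: large_mono)
  qed
  then obtain r where r: "large is (T r) e" ..
  define U where "U c e \<longleftrightarrow> (\<exists>a. a < c \<and> - r < a \<and> Q a e)" for c e
  define S where "S c \<longleftrightarrow> large is (U c) e" for c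
  have mono: "S c \<Longrightarrow> S d" if "c \<le> d" for c d
    using that unfolding S_def U_def by (elim large_mono) (meson less_le_trans)
  have dpS: "definable_pred M (\<lambda>e. S (e 0))"
    unfolding S_def
  proof (rule dp_app_env[of M "\<lambda>c. large is (U c)", OF dp_large_family])
    show "definable_pred M (\<lambda>e. U (e 0) (\<lambda>i. e (Suc i)))"
      unfolding U_def by (intro dp_app_env[OF Q] dp_intros)
  qed (rule atomic_intros)+
  have "S r" unfolding S_def using r
  proof (rule large_mono)
    fix e assume "T r e"
    then obtain a where a: "a < r" "0 < a + r" "Q a e" unfolding T_def by blast
    then have "- r < a" by linarith
    with a show "U r e" unfolding U_def by blast
  qed
  have "- r \<le> c" if "S c" for c
  proof (rule ccontr)
    assume "\<not> - r \<le> c"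
    then have "U c = (\<lambda>e. False)" by (auto simp: fun_eq_iff U_def)
    with that show False unfolding S_def by (simp add: not_large_False)
  qed
  with inf_exists[OF dpS \<open>S r\<close>] obtain s
    where s: "\<And>x. S x \<Longrightarrow> s \<le> x" "\<And>u. (\<And>x. S x \<Longrightarrow> u \<le> x) \<Longrightarrow> u \<le> s" by blast
  have "\<not> s + \<delta> / 2 \<le> s" using \<open>0 < \<delta>\<close> by simp
  then have "S (s + \<delta> / 2)" using s(2)[of "s + \<delta> / 2"] mono by (meson linear)
  have "\<not> S (s - \<delta> / 2)" using s(1)[of "s - \<delta> / 2"] \<open>0 < \<delta>\<close> by auto
  \<comment> \<open>Passing from \<open>s + \<delta> / 2\<close> down to
    \<open>s - \<delta> / 2\<close> destroys largeness, so the values in between carry it.\<close>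
  have "large is (\<lambda>e. U (s - \<delta> / 2) e \<or>
      (\<exists>a. s - \<delta> / 2 \<le> a \<and> a < s + \<delta> / 2 \<and> Q a e)) e"
    using \<open>S (s + \<delta> / 2)\<close> unfolding S_def by (rule large_mono) (unfold U_def, meson not_less)
  then have "S (s - \<delta> / 2) \<or> large is (\<lambda>e. \<exists>a. s - \<delta> / 2 \<le> a \<and> a < s + \<delta> / 2 \<and> Q a e) e"
    unfolding S_def
  proof (intro large_disj)
    show "definable_pred M (U (s - \<delta> / 2))"
      unfolding U_def by (intro dp_app_env[OF Q] dp_intros)
  qed
  with \<open>\<not> S (s - \<delta> / 2)\<close> have "large is (\<lambda>e. \<exists>a. s - \<delta> / 2 \<le> a \<and> a < s + \<delta> / 2 \<and> Q a e) e"
    by blast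
  then have "large is (\<lambda>e. \<exists>a. a < s + \<delta> \<and> s < a + \<delta> \<and> Q a e) e"
  proof (rule large_mono)
    fix e assume "\<exists>a. s - \<delta> / 2 \<le> a \<and> a < s + \<delta> / 2 \<and> Q a e"
    then obtain a where a: "s - \<delta> / 2 \<le> a" "a < s + \<delta> / 2" "Q a e" by blast
    have "\<delta> / 2 < \<delta>" using \<open>0 < \<delta>\<close> by simp
    then have "a < s + \<delta> \<and> s < a + \<delta>" using a by linarith
    with a show "\<exists>a. a < s + \<delta> \<and> s < a + \<delta> \<and> Q a e" by blast
  qed
  then show ?thesis ..
qed

end

section \<open>Closures and constructible sets\<close>

text \<open>Distance below \<open>\<epsilon>\<close> in the maximum norm on \<open>I\<close>,
  written with sums so that \<open>dp_less_add\<close> applies.\<close>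

definition near :: "nat set \<Rightarrow> 'a::linordered_field \<Rightarrow> (nat \<Rightarrow> 'a) \<Rightarrow> (nat \<Rightarrow> 'a) \<Rightarrow> bool" where
  "near I \<epsilon> x y \<longleftrightarrow> (\<forall>i\<in>I. x i < y i + \<epsilon> \<and> y i < x i + \<epsilon>)"

text \<open>Coordinates outside \<open>I\<close> are free, so this is the cylinder over the closure
  of the projection to \<open>I\<close>.\<close>

definition cl :: "nat set \<Rightarrow> ((nat \<Rightarrow> 'a::linordered_field) \<Rightarrow> bool) \<Rightarrow> (nat \<Rightarrow> 'a) \<Rightarrow> bool" where
  "cl I P e \<longleftrightarrow> (\<forall>\<epsilon>. 0 < \<epsilon> \<longrightarrow> (\<exists>x. near I \<epsilon> x e \<and> P x))"

definition supported :: "nat set \<Rightarrow> ((nat \<Rightarrow> 'a) \<Rightarrow> bool) \<Rightarrow> bool" where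
  "supported I P \<longleftrightarrow> (\<forall>x y. (\<forall>i\<in>I. x i = y i) \<longrightarrow> P x = P y)"

definition open_pred :: "nat \<Rightarrow> ((nat \<Rightarrow> 'a::linordered_field) \<Rightarrow> bool) \<Rightarrow> bool" where
  "open_pred n P \<longleftrightarrow> (\<forall>e. P e \<longrightarrow> (\<exists>\<epsilon>>0. \<forall>x. near {..<n} \<epsilon> x e \<longrightarrow> P x))"

text \<open>The open generators are required to be definable, so that constructibility and
  definability in the open core can both be read off.\<close>

inductive definably_constructible ::
  "('f, 'r, 'a::linordered_field) fo_structure \<Rightarrow> nat \<Rightarrow> ((nat \<Rightarrow> 'a) \<Rightarrow> bool) \<Rightarrow> bool" for M n where
  basic: "definable_pred M P \<Longrightarrow> open_pred n P \<Longrightarrow> definably_constructible M n P"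
| compl: "definably_constructible M n P \<Longrightarrow> definably_constructible M n (\<lambda>e. \<not> P e)"
| inter: "definably_constructible M n P \<Longrightarrow> definably_constructible M n Q \<Longrightarrow>
    definably_constructible M n (\<lambda>e. P e \<and> Q e)"

lemma definably_constructible_union:
  assumes "definably_constructible M n P" and "definably_constructible M n Q"
  shows "definably_constructible M n (\<lambda>e. P e \<or> Q e)"
  using compl[OF inter[OF compl[OF assms(1)] compl[OF assms(2)]]] by simp

text \<open>A projection is kept as a cylinder of full assignments, so the ambient space never
  changes.\<close>

definition proj :: "nat list \<Rightarrow> ((nat \<Rightarrow> 'a) \<Rightarrow> bool) \<Rightarrow> (nat \<Rightarrow> 'a) \<Rightarrow> bool" where
  "proj is P e \<longleftrightarrow> (\<exists>x. (\<forall>i\<in>set is. x i = e i) \<and> P x)"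

lemma near_refl: "0 < \<epsilon> \<Longrightarrow> near I \<epsilon> x x"
  by (simp add: near_def)

lemma near_sym: "near I \<epsilon> x y \<Longrightarrow> near I \<epsilon> y x"
  by (simp add: near_def)

lemma near_trans:
  assumes "near I \<epsilon> x y" and "near I \<delta> y z"
  shows "near I (\<epsilon> + \<delta>) x z"
  unfolding near_def
proof
  fix i assume "i \<in> I"
  then have "x i < y i + \<epsilon>" "y i < x i + \<epsilon>" "y i < z i + \<delta>" "z i < y i + \<delta>"
    using assms by (auto simp: near_def)
  then show "x i < z i + (\<epsilon> + \<delta>) \<and> z i < x i + (\<epsilon> + \<delta>)" by linarith
qed

lemma near_mono: "near I \<epsilon> x y \<Longrightarrow> J \<subseteq> I \<Longrightarrow> \<epsilon> \<le> \<delta> \<Longrightarrow> near J \<delta> x y"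
  unfolding near_def by (meson add_left_mono less_le_trans subsetD)

lemma near_cong:
  "(\<And>i. i \<in> I \<Longrightarrow> x i = x' i) \<Longrightarrow> (\<And>i. i \<in> I \<Longrightarrow> y i = y' i) \<Longrightarrow> near I \<epsilon> x y = near I \<epsilon> x' y'"
  by (simp add: near_def)

lemma cl_subset: "P e \<Longrightarrow> cl I P e"
  unfolding cl_def using near_refl by blast

lemma supported_mono: "supported I P \<Longrightarrow> I \<subseteq> J \<Longrightarrow> supported J P"
  unfolding supported_def by blast

lemma supportedD: "supported I P \<Longrightarrow> (\<And>i. i \<in> I \<Longrightarrow> x i = y i) \<Longrightarrow> P x = P y"
  unfolding supported_def by blast

lemma supported_cl: "supported I (cl I P)"
proof -
  have "near I \<epsilon> z x = near I \<epsilon> z y" if "\<forall>i\<in>I. x i = y i" for x y z \<epsilon>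
    using that by (intro near_cong) auto
  then show ?thesis unfolding supported_def cl_def by metis
qed

lemma supported_proj: "supported (set is) (proj is P)"
  unfolding supported_def proj_def by metis

lemma open_pred_not_cl:
  assumes "I \<subseteq> {..<n}"
  shows "open_pred n (\<lambda>e. \<not> cl I P e)"
  unfolding open_pred_def
proof (intro allI impI)
  fix e assume "\<not> cl I P e"
  then obtain \<epsilon> where \<epsilon>: "0 < \<epsilon>" "\<And>x. near I \<epsilon> x e \<Longrightarrow> \<not> P x" unfolding cl_def by blast
  have "\<not> cl I P x" if x: "near {..<n} (\<epsilon> / 2) x e" for x
  proof
    assume "cl I P x"
    then obtain y where y: "near I (\<epsilon> / 2) y x" "P y" unfolding cl_def using \<epsilon>(1) half_gt_zero by blast
    have "near I (\<epsilon> / 2) x e" using x assms by (rule near_mono) simp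
    from near_trans[OF y(1) this] have "near I \<epsilon> y e" by simp
    with \<epsilon> y show False by blast
  qed
  then show "\<exists>\<epsilon>>0. \<forall>x. near {..<n} \<epsilon> x e \<longrightarrow> \<not> cl I P x" using \<epsilon>(1) half_gt_zero by blast
qed

text \<open>The last coordinate is the innermost one, so induction from the end sees intervals over
  the shorter list.\<close>

lemma large_snoc: "large (is @ [j]) P e = large is (\<lambda>e. has_ivl (\<lambda>a. P (e(j := a)))) e"
  by (induction "is" arbitrary: e) auto

section \<open>Boxes, closures and the decomposition of definable sets\<close>

context definably_complete_lom
begin

lemma dp_near:
  assumes "finite I" and "atomic h" and "\<And>i. atomic (\<lambda>e. f e i)" and "\<And>i. atomic (\<lambda>e. g e i)"
  shows "definable_pred M (\<lambda>e. near I (h e) (f e) (g e))"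
  unfolding near_def by (intro dp_ball dp_intros assms)

lemma dp_agree:
  assumes "\<And>i. atomic (\<lambda>e. f e i)" and "\<And>i. atomic (\<lambda>e. g e i)"
  shows "definable_pred M (\<lambda>e. \<forall>i\<in>set is. f e i = g e i)"
  by (intro dp_ball finite_set dp_eq assms)

lemma dp_cl:
  assumes dp: "definable_pred M P" and supp: "supported {..<n} P" and I: "I \<subseteq> {..<n}"
  shows "definable_pred M (cl I P)"
  unfolding cl_def
proof (intro dp_intros dp_ex_vec[where n = n])
  show "(near I \<epsilon> x e \<and> P x) = (near I \<epsilon> y e \<and> P y)" if "\<And>i. i < n \<Longrightarrow> x i = y i" for x y e \<epsilon>
  proof -
    have "near I \<epsilon> x e = near I \<epsilon> y e" using that I by (intro near_cong) auto
    moreover have "P x = P y" using that by (intro supportedD[OF supp]) simp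
    ultimately show ?thesis by simp
  qed
  have "finite I" using I by (rule finite_subset) simp
  then show "definable_pred M (\<lambda>e. near I (e (n + 0)) (\<lambda>i. e i) (\<lambda>i. e (n + Suc i)))"
    by (intro dp_near atomic_intros)
  show "definable_pred M (\<lambda>e. P (\<lambda>i. e i))" using dp by simp
qed

lemma dp_proj:
  assumes dp: "definable_pred M P" and supp: "supported {..<n} P" and I: "set is \<subseteq> {..<n}"
  shows "definable_pred M (proj is P)"
  unfolding proj_def
proof (intro dp_conj dp_ex_vec[where n = n])
  show "((\<forall>i\<in>set is. x i = e i) \<and> P x) = ((\<forall>i\<in>set is. y i = e i) \<and> P y)"
    if *: "\<And>i. i < n \<Longrightarrow> x i = y i" for x y e
  proof -
    have "x i = y i" if "i \<in> set is" for i using that * I by auto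
    moreover have "P x = P y" using * by (intro supportedD[OF supp]) simp
    ultimately show ?thesis by simp
  qed
  show "definable_pred M (\<lambda>e. \<forall>i\<in>set is. e i = e (n + i))" by (intro dp_agree atomic_intros)
  show "definable_pred M (\<lambda>e. P (\<lambda>i. e i))" using dp by simp
qed

text \<open>In the iterated quantifier the interval for the last coordinate may vary with the
  others. The chain property fixes its length, the pigeonhole its position.\<close>

lemma large_box:
  "\<lbrakk>definable_pred M P; distinct is; large is P e0\<rbrakk> \<Longrightarrow>
     \<exists>e \<epsilon>. 0 < \<epsilon> \<and> (\<forall>i. i \<notin> set is \<longrightarrow> e i = e0 i) \<and>
       (\<forall>x. (\<forall>i. i \<notin> set is \<longrightarrow> x i = e0 i) \<and> near (set is) \<epsilon> x e \<longrightarrow> P x)"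
proof (induction "is" arbitrary: P rule: rev_induct)
  case Nil
  have "x = e0" if "\<forall>i. x i = e0 i" for x using that by auto
  then show ?case using Nil zero_less_one by (intro exI[of _ e0] exI[of _ 1]) auto
next
  case (snoc j "is")
  note P = snoc.prems(1)
  define Q where "Q a t e \<longleftrightarrow> (\<forall>x. a < x \<and> x < a + t \<longrightarrow> P (e(j := x)))" for a t e
  \<comment> \<open>Members with nonpositive \<open>t\<close> are empty, so a large member provides
    a positive length.\<close>
  define T where "T t e \<longleftrightarrow> 0 < t \<and> (\<exists>a. Q a t e)" for t e
  have "\<exists>t. large is (T t) e0"
  proof (rule large_chain)
    show "definable_pred M (\<lambda>e. T (e 0) (\<lambda>i. e (Suc i)))"
      unfolding T_def Q_def by (intro dp_intros dp_sub[OF P])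
    have mono: "T t e" if "T t' e" "0 < t" "t \<le> t'" for t t' e
      using that unfolding T_def Q_def by (meson add_left_mono less_le_trans)
    show "(\<forall>e. T t e \<longrightarrow> T t' e) \<or> (\<forall>e. T t' e \<longrightarrow> T t e)" for t t'
      using mono linear[of t t'] unfolding T_def by metis
    have "large is (\<lambda>e. has_ivl (\<lambda>a. P (e(j := a)))) e0"
      using snoc.prems(3) by (simp only: large_snoc)
    then show "large is (\<lambda>e. \<exists>t. T t e) e0"
    proof (rule large_mono)
      fix e assume "has_ivl (\<lambda>a. P (e(j := a)))"
      then obtain a b where "a < b" "\<And>x. a < x \<and> x < b \<Longrightarrow> P (e(j := x))"
        unfolding has_ivl_def by blast
      then show "\<exists>t. T t e" unfolding T_def Q_def
        by (intro exI[of _ "b - a"] conjI exI[of _ a]) auto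
    qed
  qed
  then obtain t where t: "large is (T t) e0" ..
  have "0 < t"
  proof (rule ccontr)
    assume "\<not> 0 < t"
    then have "T t = (\<lambda>e. False)" by (auto simp: T_def)
    with t show False by (simp add: not_large_False)
  qed
  \<comment> \<open>If \<open>a\<close> is within \<open>d\<close> of \<open>c\<close>, the interval
    from \<open>a\<close> to \<open>a + 4d\<close> contains the one from \<open>c + d\<close> to
    \<open>c + 3d\<close>, whose centre is \<open>c + 2d\<close>.\<close>
  define d where "d = t / 4"
  have d: "0 < d" "t = d + d + d + d" using \<open>0 < t\<close> by (auto simp: d_def)
  have "large is (\<lambda>e. \<exists>a. Q a t e) e0" using t by (rule large_mono) (simp add: T_def)
  moreover have "definable_pred M (\<lambda>e. Q (e 0) t (\<lambda>i. e (Suc i)))"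
    unfolding Q_def by (intro dp_intros dp_sub[OF P])
  ultimately obtain c where
    c: "large is (\<lambda>e. \<exists>a. a < c + d \<and> c < a + d \<and> Q a t e) e0"
    using pigeonhole[of "\<lambda>a. Q a t" "is" e0 d] d by blast
  define R where "R e \<longleftrightarrow> (\<forall>x. c + d < x \<and> x < c + (d + d + d) \<longrightarrow> P (e(j := x)))" for e
  have "large is R e0" using c
  proof (rule large_mono)
    fix e assume "\<exists>a. a < c + d \<and> c < a + d \<and> Q a t e"
    then obtain a where a: "a < c + d" "c < a + d" "Q a t e" by blast
    have "a < x \<and> x < a + t" if "c + d < x" "x < c + (d + d + d)" for x
      using that a d by linarith
    with a(3) show "R e" unfolding R_def Q_def by blast
  qed
  moreover have "definable_pred M R"
    unfolding R_def by (intro dp_intros dp_sub[OF P])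
  moreover have "distinct is" using snoc.prems(2) by simp
  ultimately have "\<exists>e \<epsilon>. 0 < \<epsilon> \<and> (\<forall>i. i \<notin> set is \<longrightarrow> e i = e0 i) \<and>
      (\<forall>x. (\<forall>i. i \<notin> set is \<longrightarrow> x i = e0 i) \<and> near (set is) \<epsilon> x e \<longrightarrow> R x)"
    by (intro snoc.IH)
  then obtain e \<epsilon> where e: "0 < \<epsilon>" "\<forall>i. i \<notin> set is \<longrightarrow> e i = e0 i"
    "\<forall>x. (\<forall>i. i \<notin> set is \<longrightarrow> x i = e0 i) \<and> near (set is) \<epsilon> x e \<longrightarrow> R x" by (elim exE conjE)
  show ?case
  proof (intro exI conjI allI impI)
    show "0 < min \<epsilon> d" using e d by simp
    show "(e(j := c + (d + d))) i = e0 i" if "i \<notin> set (is @ [j])" for i using that e by auto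
  next
    fix x
    assume "(\<forall>i. i \<notin> set (is @ [j]) \<longrightarrow> x i = e0 i) \<and>
      near (set (is @ [j])) (min \<epsilon> d) x (e(j := c + (d + d)))"
    then have x: "\<And>i. i \<notin> set (is @ [j]) \<Longrightarrow> x i = e0 i"
      and nx: "near (set (is @ [j])) (min \<epsilon> d) x (e(j := c + (d + d)))" by blast+
    have "j \<notin> set is" using snoc.prems(2) by simp
    have "near (set is) \<epsilon> x (e(j := c + (d + d)))" using nx by (rule near_mono) auto
    \<comment> \<open>\<open>R\<close> does not see coordinate \<open>j\<close>, which may thus be
      reset to \<open>e0 j\<close> as the induction hypothesis demands.\<close>
    also have "near (set is) \<epsilon> x (e(j := c + (d + d))) = near (set is) \<epsilon> (x(j := e0 j)) e"
      using \<open>j \<notin> set is\<close> by (intro near_cong) auto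
    finally have "R (x(j := e0 j))" using x by (intro e(3)[rule_format]) auto
    moreover have "x j < c + (d + d) + min \<epsilon> d" "c + (d + d) < x j + min \<epsilon> d"
      using nx by (auto simp: near_def)
    then have "c + d < x j" "x j < c + (d + d + d)" using min.cobounded2[of \<epsilon> d] by linarith+
    ultimately show "P x" unfolding R_def by (metis fun_upd_triv fun_upd_upd)
  qed
qed

text \<open>The witness is confined one coordinate at a time; what is already confined joins the
  predicate for the next.\<close>

lemma pigeonhole_vec:
  fixes Q :: "(nat \<Rightarrow> 'a) \<Rightarrow> (nat \<Rightarrow> 'a) \<Rightarrow> bool"
  assumes supp: "\<And>x y e. (\<And>i. i < n \<Longrightarrow> x i = y i) \<Longrightarrow> Q x e = Q y e"
    and dp: "definable_pred M (\<lambda>e. Q (\<lambda>i. e i) (\<lambda>i. e (n + i)))"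
    and "finite J" and "0 < \<delta>"
  shows "J \<subseteq> {..<n} \<Longrightarrow> large is (\<lambda>e. \<exists>x. Q x e) e0 \<Longrightarrow>
    \<exists>c. large is (\<lambda>e. \<exists>x. near J \<delta> x c \<and> Q x e) e0"
  using \<open>finite J\<close>
proof (induction J rule: finite_induct)
  case empty
  then show ?case by (simp add: near_def)
next
  case (insert j J)
  then obtain c where c: "large is (\<lambda>e. \<exists>x. near J \<delta> x c \<and> Q x e) e0" by blast
  let ?Q = "\<lambda>a e. \<exists>x. x j = a \<and> near J \<delta> x c \<and> Q x e"
  have "large is (\<lambda>e. \<exists>a. ?Q a e) e0" using c by (rule large_mono) blast
  moreover have "definable_pred M (\<lambda>e. ?Q (e 0) (\<lambda>i. e (Suc i)))"
  proof (intro dp_ex_vec[where n = n] dp_conj dp_eq dp_near insert.hyps atomic_intros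
      dp_app_vec[of n Q, OF supp dp])
    fix x y e :: "nat \<Rightarrow> 'a" assume *: "\<And>i. i < n \<Longrightarrow> x i = y i"
    have "near J \<delta> x c = near J \<delta> y c" using * insert.prems(1) by (intro near_cong) auto
    then show "(x j = e 0 \<and> near J \<delta> x c \<and> Q x (\<lambda>i. e (Suc i))) =
        (y j = e 0 \<and> near J \<delta> y c \<and> Q y (\<lambda>i. e (Suc i)))"
      using supp[OF *] * insert.prems(1) by auto
  qed
  ultimately obtain b where b: "large is (\<lambda>e. \<exists>a. a < b + \<delta> \<and> b < a + \<delta> \<and> ?Q a e) e0"
    using pigeonhole[of ?Q] \<open>0 < \<delta>\<close> by blast
  have "large is (\<lambda>e. \<exists>x. near (insert j J) \<delta> x (c(j := b)) \<and> Q x e) e0" using b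
  proof (rule large_mono)
    fix e assume "\<exists>a. a < b + \<delta> \<and> b < a + \<delta> \<and> ?Q a e"
    then obtain x where x: "x j < b + \<delta>" "b < x j + \<delta>" "near J \<delta> x c" "Q x e" by blast
    then have "near (insert j J) \<delta> x (c(j := b))" using insert.hyps by (auto simp: near_def)
    with x show "\<exists>x. near (insert j J) \<delta> x (c(j := b)) \<and> Q x e" by blast
  qed
  then show ?case by (rule exI[of _ "c(j := b)"])
qed

text \<open>Otherwise the closure without \<open>N\<close> is large and contains a box. Its centre
  lies in the closure, so \<open>N\<close> meets the box.\<close>

lemma not_large_cl:
  assumes N: "definable_pred M N" and supp: "supported (set is) N" and "distinct is"
    and not: "\<not> large is N e0"
  shows "\<not> large is (cl (set is) N) e0"
proof
  assume "large is (cl (set is) N) e0"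
  then have "large is (\<lambda>e. N e \<or> (cl (set is) N e \<and> \<not> N e)) e0" by (rule large_mono) blast
  from large_disj[OF N this] not have l: "large is (\<lambda>e. cl (set is) N e \<and> \<not> N e) e0" by blast
  obtain n where n: "set is \<subseteq> {..<n}" using finite_nat_iff_bounded by blast
  have "definable_pred M (\<lambda>e. cl (set is) N e \<and> \<not> N e)"
    by (intro dp_conj dp_not N dp_cl[OF N supported_mono[OF supp n] n])
  from large_box[OF this \<open>distinct is\<close> l] obtain e \<epsilon> where e: "0 < \<epsilon>"
    "\<forall>i. i \<notin> set is \<longrightarrow> e i = e0 i"
    "\<And>x. \<lbrakk>\<forall>i. i \<notin> set is \<longrightarrow> x i = e0 i; near (set is) \<epsilon> x e\<rbrakk> \<Longrightarrow> cl (set is) N x \<and> \<not> N x"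
    by blast
  from e(3)[OF e(2) near_refl[OF e(1)]] obtain x where x: "near (set is) \<epsilon> x e" "N x"
    unfolding cl_def using e(1) by blast
  \<comment> \<open>The point of \<open>N\<close> found near the centre is arbitrary outside
    \<open>is\<close>; \<open>N\<close> ignores those coordinates, so they are reset to fit the
    box.\<close>
  let ?x = "\<lambda>i. if i \<in> set is then x i else e0 i"
  have "near (set is) \<epsilon> ?x e = near (set is) \<epsilon> x e" by (rule near_cong) auto
  with x e(3)[of ?x] have "\<not> N ?x" by auto
  moreover have "N ?x = N x" by (rule supportedD[OF supp]) auto
  ultimately show False using x by simp
qed

text \<open>A definable set with closed fibres over the coordinates \<open>is\<close> is relatively closed over
  generic points of the base: otherwise, some frontier point over each point of a large set has a
  fixed distance from the fibre, and by the pigeonhole principle these frontier points may be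
  taken close to a fixed \<open>c\<close>, so that there is a box around \<open>c\<close> missing the set over a box
  in the base.\<close>

lemma not_large_frontier_fibres:
  assumes dp: "definable_pred M X" and supp: "supported {..<n} X"
    and "is": "distinct is" "set is \<subseteq> {..<n}"
    and closed: "\<And>x. (\<And>\<epsilon>. 0 < \<epsilon> \<Longrightarrow> \<exists>y. (\<forall>i\<in>set is. y i = x i) \<and> near {..<n} \<epsilon> y x \<and> X y) \<Longrightarrow> X x"
  shows "\<not> large is (proj is (\<lambda>x. cl {..<n} X x \<and> \<not> X x)) e0"
proof
  assume l: "large is (proj is (\<lambda>x. cl {..<n} X x \<and> \<not> X x)) e0"
  define W where "W t x \<longleftrightarrow> \<not> (\<exists>y. (\<forall>i\<in>set is. y i = x i) \<and> near {..<n} t y x \<and> X y)" for t x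
  define Q where "Q t x e \<longleftrightarrow> (\<forall>i\<in>set is. x i = e i) \<and> cl {..<n} X x \<and> W t x" for t x e
  define Z where "Z t e \<longleftrightarrow> 0 < t \<and> (\<exists>x. Q t x e)" for t e
  have dpW: "definable_pred M (\<lambda>e. W (e 0) (\<lambda>i. e (Suc i)))"
    unfolding W_def
  proof (intro dp_not dp_ex_vec[where n = n] dp_conj dp_agree dp_near finite_lessThan atomic_intros)
    fix x y e :: "nat \<Rightarrow> 'a" assume *: "\<And>i. i < n \<Longrightarrow> x i = y i"
    have "near {..<n} (e 0) x (\<lambda>i. e (Suc i)) = near {..<n} (e 0) y (\<lambda>i. e (Suc i))"
      using * by (intro near_cong) auto
    moreover have "X x = X y" using * by (intro supportedD[OF supp]) simp
    moreover have "x i = y i" if "i \<in> set is" for i using that * "is"(2) by auto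
    ultimately show "((\<forall>i\<in>set is. x i = e (Suc i)) \<and> near {..<n} (e 0) x (\<lambda>i. e (Suc i)) \<and> X x) =
        ((\<forall>i\<in>set is. y i = e (Suc i)) \<and> near {..<n} (e 0) y (\<lambda>i. e (Suc i)) \<and> X y)"
      by simp
  next
    show "definable_pred M (\<lambda>e. X (\<lambda>i. e i))" using dp by simp
  qed
  have dpcl: "definable_pred M (cl {..<n} X)" by (rule dp_cl[OF dp supp]) simp
  have suppQ: "Q t x e = Q t y e" if *: "\<And>i. i < n \<Longrightarrow> x i = y i" for t x y e
  proof -
    have "cl {..<n} X x = cl {..<n} X y" using * by (intro supportedD[OF supported_cl]) auto
    moreover have "near {..<n} t z x = near {..<n} t z y" for z using * by (intro near_cong) auto
    moreover have "x i = y i" if "i \<in> set is" for i using that * "is"(2) by auto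
    ultimately show ?thesis unfolding Q_def W_def by simp
  qed
  have "\<exists>t. large is (Z t) e0"
  proof (rule large_chain)
    show "definable_pred M (\<lambda>e. Z (e 0) (\<lambda>i. e (Suc i)))"
      unfolding Z_def
    proof (intro dp_conj dp_less dp_ex_vec[where n = n] atomic_intros)
      show "definable_pred M (\<lambda>e. Q (e (n + 0)) (\<lambda>i. e i) (\<lambda>i. e (n + Suc i)))"
        unfolding Q_def
        by (intro dp_conj dp_agree dp_sub[OF dpcl] dp_app_env[of M W, OF dpW] atomic_intros)
    qed (rule suppQ)
    have mono: "Z t e" if "Z t' e" "0 < t" "t \<le> t'" for t t' e
    proof -
      have "near {..<n} t' y x" if "near {..<n} t y x" for x y
        using that \<open>t \<le> t'\<close> by (elim near_mono) auto
      then have "W t' x \<Longrightarrow> W t x" for x unfolding W_def by blast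
      with that show ?thesis unfolding Z_def Q_def by blast
    qed
    show "(\<forall>e. Z t e \<longrightarrow> Z t' e) \<or> (\<forall>e. Z t' e \<longrightarrow> Z t e)" for t t'
      using mono linear[of t t'] unfolding Z_def by metis
    show "large is (\<lambda>e. \<exists>t. Z t e) e0" using l
    proof (rule large_mono)
      fix e assume "proj is (\<lambda>x. cl {..<n} X x \<and> \<not> X x) e"
      then obtain x where x: "\<forall>i\<in>set is. x i = e i" "cl {..<n} X x" "\<not> X x" unfolding proj_def by blast
      from closed[of x] x(3) obtain \<epsilon> where "0 < \<epsilon>" "W \<epsilon> x" unfolding W_def by blast
      with x show "\<exists>t. Z t e" unfolding Z_def Q_def by blast
    qed
  qed
  then obtain t where t: "large is (Z t) e0" ..
  have "0 < t"
  proof (rule ccontr)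
    assume "\<not> 0 < t"
    then have "Z t = (\<lambda>e. False)" by (auto simp: Z_def)
    with t show False by (simp add: not_large_False)
  qed
  \<comment> \<open>One third for each of the passages from \<open>y\<close> to \<open>x\<close>, to
    \<open>c\<close> and to \<open>w\<close> below.\<close>
  define d where "d = t / 3"
  have d: "0 < d" "t = d + d + d" using \<open>0 < t\<close> by (auto simp: d_def)
  define J where "J = {..<n} - set is"
  have J: "finite J" "J \<subseteq> {..<n}" unfolding J_def by auto
  have dpQ: "definable_pred M (\<lambda>e. Q t (\<lambda>i. e i) (\<lambda>i. e (n + i)))"
    unfolding Q_def
    by (intro dp_conj dp_agree dp_sub[OF dpcl] dp_app_env[of M W, OF dpW] atomic_intros)
  have "large is (\<lambda>e. \<exists>x. Q t x e) e0" using t by (rule large_mono) (simp add: Z_def)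
  from pigeonhole_vec[where Q = "Q t", OF suppQ dpQ J(1) d(1) J(2) this]
  obtain c where c: "large is (\<lambda>e. \<exists>x. near J d x c \<and> Q t x e) e0" by blast
  have "definable_pred M (\<lambda>e. \<exists>x. near J d x c \<and> Q t x e)"
  proof (intro dp_ex_vec[where n = n] dp_conj dp_near J atomic_intros dpQ)
    fix x y e :: "nat \<Rightarrow> 'a" assume *: "\<And>i. i < n \<Longrightarrow> x i = y i"
    have "near J d x c = near J d y c" using * J(2) by (intro near_cong) auto
    then show "(near J d x c \<and> Q t x e) = (near J d y c \<and> Q t y e)" using suppQ[OF *] by simp
  qed
  from large_box[OF this "is"(1) c] obtain e \<epsilon> where e: "0 < \<epsilon>"
    "\<forall>i. i \<notin> set is \<longrightarrow> e i = e0 i"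
    "\<And>z. \<lbrakk>\<forall>i. i \<notin> set is \<longrightarrow> z i = e0 i; near (set is) \<epsilon> z e\<rbrakk> \<Longrightarrow> \<exists>x. near J d x c \<and> Q t x z"
    by blast
  \<comment> \<open>The frontier point \<open>x\<close> over the centre is approached by a point
    \<open>y\<close> of \<open>X\<close> over the box. The frontier point \<open>w\<close> over the
    base point of \<open>y\<close> then lies in the same fibre as \<open>y\<close>, closer than
    \<open>t\<close>, against \<open>W t w\<close>.\<close>
  obtain x where x: "near J d x c" "Q t x e" using e(3)[OF e(2) near_refl[OF e(1)]] by blast
  obtain y where y: "near {..<n} (min \<epsilon> d) y x" "X y"
    using x(2) e(1) d(1) unfolding Q_def cl_def by (meson min_less_iff_conj)
  let ?z = "\<lambda>i. if i \<in> set is then y i else e0 i"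
  have "near (set is) \<epsilon> y x" using y(1) "is"(2) by (rule near_mono) simp
  also have "near (set is) \<epsilon> y x = near (set is) \<epsilon> ?z e"
    using x(2) by (intro near_cong) (auto simp: Q_def)
  finally obtain w where w: "near J d w c" "Q t w ?z" using e(3)[of ?z] by auto
  have yw: "y i = w i" if "i \<in> set is" for i using w(2) that by (simp add: Q_def)
  have "near J d y x" using y(1) J(2) by (rule near_mono) simp
  from near_trans[OF near_trans[OF this x(1)] near_sym[OF w(1)]] have "near J t y w" by (simp add: d)
  then have "near {..<n} t y w" using yw \<open>0 < t\<close> unfolding near_def J_def by (metis DiffI less_add_same_cancel1)
  with yw y(2) have "\<not> W t w" unfolding W_def by blast
  with w(2) show False by (simp add: Q_def)
qed

lemma definably_constructible:
  "definable_pred M X \<Longrightarrow> supported {..<n} X \<Longrightarrow> definably_constructible M n X"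
proof (induction "card {is. (set is \<subseteq> {..<n} \<and> distinct is) \<and> large is (proj is X) (\<lambda>_. 0)}"
    arbitrary: X rule: less_induct)
  case (less X)
  note dp = less.prems(1) and supp = less.prems(2)
  \<comment> \<open>Serves only as a starting point: \<open>proj is Y\<close> depends on the
    coordinates in \<open>is\<close>, and \<open>large is\<close> overwrites them all.\<close>
  let ?e0 = "\<lambda>_. 0 :: 'a"
  define D where "D Y = {is. (set is \<subseteq> {..<n} \<and> distinct is) \<and> large is (proj is Y) ?e0}" for Y
  have fin: "finite (D Y)" for Y
    using finite_subset_distinct[of "{..<n}"] unfolding D_def by (rule finite_subset[rotated]) auto
  show ?case
  proof (cases "\<exists>x. X x")
    case False
    then have "open_pred n X" by (simp add: open_pred_def)
    with dp show ?thesis by (rule basic)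
  next
    case True
    \<comment> \<open>Largeness for the empty list is nonemptiness, so a longest list
      exists.\<close>
    then have "[] \<in> D X" by (auto simp: D_def proj_def)
    then have "Max (length ` D X) \<in> length ` D X" using fin by (intro Max_in) auto
    then obtain "is" where isD: "is \<in> D X" and "length is = Max (length ` D X)" by auto
    then have maximal: "length js \<le> length is" if "js \<in> D X" for js using fin that by simp
    have "is": "distinct is" "set is \<subseteq> {..<n}" using isD by (auto simp: D_def)
    \<comment> \<open>For such a subset \<open>is\<close> leaves the counted set and, by
      monotonicity, no list enters it.\<close>
    have smaller: "definably_constructible M n Y"
      if Y: "definable_pred M Y" "supported {..<n} Y" "\<And>e. Y e \<Longrightarrow> X e" "\<not> large is (proj is Y) ?e0" for Y
    proof -
      have "proj js Y e \<Longrightarrow> proj js X e" for js e using Y(3) unfolding proj_def by blast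
      then have "D Y \<subseteq> D X" unfolding D_def using large_mono by blast
      moreover have "is \<notin> D Y" using Y(4) by (simp add: D_def)
      ultimately have "card (D Y) < card (D X)" using isD fin by (intro psubset_card_mono) auto
      then show ?thesis using less.hyps[of Y] Y(1,2) unfolding D_def by blast
    qed
    \<comment> \<open>Over these base points some remaining coordinate fills an interval; if they
      formed a large set, \<open>is @ [j]\<close> would be a longer list.\<close>
    define bad where "bad e \<longleftrightarrow>
      (\<exists>j\<in>{..<n} - set is. has_ivl (\<lambda>a. proj (is @ [j]) X (e(j := a))))" for e
    have dpproj: "definable_pred M (proj (is @ [j]) X)" if "j \<in> {..<n} - set is" for j
      using that "is" by (intro dp_proj[OF dp supp]) auto
    have dpbad1: "definable_pred M (\<lambda>e. has_ivl (\<lambda>a. proj (is @ [j]) X (e(j := a))))"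
      if "j \<in> {..<n} - set is" for j
      by (intro dp_intros dp_sub[OF dpproj[OF that]])
    then have dpbad: "definable_pred M bad" unfolding bad_def by (intro dp_bex) auto
    have suppbad: "supported (set is) bad"
      unfolding supported_def
    proof (intro allI impI)
      fix x y :: "nat \<Rightarrow> 'a" assume "\<forall>i\<in>set is. x i = y i"
      then have "proj (is @ [j]) X (x(j := a)) = proj (is @ [j]) X (y(j := a))" for a j
        by (intro supportedD[OF supported_proj]) auto
      then show "bad x = bad y" unfolding bad_def by simp
    qed
    have "\<not> large is bad ?e0"
    proof
      assume "large is bad ?e0"
      then have "\<exists>j\<in>{..<n} - set is.
          large is (\<lambda>e. has_ivl (\<lambda>a. proj (is @ [j]) X (e(j := a)))) ?e0"
        unfolding bad_def using dpbad1 by (intro large_bex) auto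
      then obtain j where "j \<in> {..<n} - set is" "large (is @ [j]) (proj (is @ [j]) X) ?e0"
        by (auto simp only: large_snoc)
      then have "is @ [j] \<in> D X" using "is" by (simp add: D_def)
      from maximal[OF this] show False by simp
    qed
    define X1 where "X1 e \<longleftrightarrow> X e \<and> \<not> bad e" for e
    \<comment> \<open>The closure makes the complement of \<open>E\<close> open, and by
      \<open>not_large_cl\<close> it does not create largeness.\<close>
    define E where "E = cl (set is) (proj is (\<lambda>x. cl {..<n} X1 x \<and> \<not> X1 x))"
    have suppbad': "supported {..<n} bad" using suppbad "is"(2) by (rule supported_mono)
    have dp1: "definable_pred M X1" unfolding X1_def by (intro dp_conj dp_not dp dpbad)
    have supp1: "supported {..<n} X1"
      using supp suppbad' unfolding supported_def X1_def by blast
    have closed: "X1 x"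
      if x: "\<And>\<epsilon>. 0 < \<epsilon> \<Longrightarrow> \<exists>y. (\<forall>i\<in>set is. y i = x i) \<and> near {..<n} \<epsilon> y x \<and> X1 y" for x
    proof -
      obtain y0 where "\<forall>i\<in>set is. y0 i = x i" "X1 y0" using x[of 1] by auto
      then have "\<not> bad x" using supportedD[OF suppbad, of y0 x] by (auto simp: X1_def)
      \<comment> \<open>Every remaining coordinate is isolated at its value in \<open>x\<close>, so
        a point of the fibre close enough to \<open>x\<close> agrees with it below
        \<open>n\<close>.\<close>
      have "\<exists>\<epsilon>>0. \<forall>z. proj (is @ [j]) X (x(j := z)) \<and> z < x j + \<epsilon> \<and> x j < z + \<epsilon> \<longrightarrow> z = x j"
        if j: "j \<in> {..<n} - set is" for j
      proof (rule isolated)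
        show "definable_pred M (\<lambda>e. proj (is @ [j]) X (x(j := e 0)))"
          by (intro dp_sub[OF dpproj[OF j]] dp_intros)
        show "\<not> has_ivl (\<lambda>z. proj (is @ [j]) X (x(j := z)))"
          using \<open>\<not> bad x\<close> j unfolding bad_def by blast
      qed
      then obtain g where g: "\<And>j. j \<in> {..<n} - set is \<Longrightarrow> g j > 0"
        "\<And>j z. \<lbrakk>j \<in> {..<n} - set is; proj (is @ [j]) X (x(j := z)); z < x j + g j; x j < z + g j\<rbrakk> \<Longrightarrow> z = x j"
        by metis
      \<comment> \<open>The element 1 covers the case that \<open>is\<close> already lists all
        coordinates.\<close>
      define \<epsilon> where "\<epsilon> = Min (insert 1 (g ` ({..<n} - set is)))"
      have "0 < \<epsilon>" unfolding \<epsilon>_def using g by (subst Min_gr_iff) auto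
      have \<epsilon>: "\<epsilon> \<le> g j" if "j \<in> {..<n} - set is" for j
        unfolding \<epsilon>_def using that by (intro Min_le) auto
      obtain y where y: "\<forall>i\<in>set is. y i = x i" "near {..<n} \<epsilon> y x" "X1 y"
        using x[OF \<open>0 < \<epsilon>\<close>] by blast
      have "y i = x i" if "i < n" for i
      proof (cases "i \<in> set is")
        case False
        then have i: "i \<in> {..<n} - set is" using that by simp
        have "y i < x i + \<epsilon>" "x i < y i + \<epsilon>" using y(2) that by (auto simp: near_def)
        then have "y i < x i + g i" "x i < y i + g i" using \<epsilon>[OF i] by linarith+
        moreover have "proj (is @ [i]) X (x(i := y i))"
          unfolding proj_def using y(1,3) by (intro exI[of _ y]) (auto simp: X1_def)
        ultimately show ?thesis using g(2)[OF i] by blast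
      qed (use y in simp)
      then show ?thesis using y(3) supportedD[OF supp1, of y x] by simp
    qed
    have dpF: "definable_pred M (\<lambda>x. cl {..<n} X1 x \<and> \<not> X1 x)"
      by (intro dp_conj dp_not dp1 dp_cl[OF dp1 supp1]) simp
    have suppF: "supported {..<n} (\<lambda>x. cl {..<n} X1 x \<and> \<not> X1 x)"
      using supp1 supported_cl[of "{..<n}" X1] unfolding supported_def by blast
    note dpN = dp_proj[OF dpF suppF "is"(2)]
    have dpE: "definable_pred M E" unfolding E_def
      by (rule dp_cl[OF dpN supported_mono[OF supported_proj "is"(2)] "is"(2)])
    have suppE: "supported (set is) E" unfolding E_def by (rule supported_cl)
    have "\<not> large is E ?e0" unfolding E_def
      by (intro not_large_cl dpN supported_proj "is" not_large_frontier_fibres[OF dp1 supp1 "is" closed])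
    have not_proj: "\<not> large is (proj is (\<lambda>e. Y e \<and> Z e)) ?e0"
      if "supported (set is) Z" "\<not> large is Z ?e0" for Y Z
    proof
      assume "large is (proj is (\<lambda>e. Y e \<and> Z e)) ?e0"
      then have "large is Z ?e0"
        by (rule large_mono) (use that(1) in \<open>auto simp: proj_def supported_def\<close>)
      with that show False by blast
    qed
    have c2: "definably_constructible M n (\<lambda>e. X e \<and> bad e)"
    proof (rule smaller)
      show "supported {..<n} (\<lambda>e. X e \<and> bad e)" using supp suppbad' unfolding supported_def by blast
    qed (use not_proj[OF suppbad \<open>\<not> large is bad ?e0\<close>] in \<open>auto intro: dp_conj dp dpbad\<close>)
    have c1: "definably_constructible M n (\<lambda>e. X1 e \<and> E e)"
    proof (rule smaller)
      show "supported {..<n} (\<lambda>e. X1 e \<and> E e)"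
        using supp1 supported_mono[OF suppE "is"(2)] unfolding supported_def by blast
      show "X e" if "X1 e \<and> E e" for e using that by (simp add: X1_def)
    qed (use not_proj[OF suppE \<open>\<not> large is E ?e0\<close>] in \<open>auto intro: dp_conj dp1 dpE\<close>)
    have nE: "definably_constructible M n (\<lambda>e. \<not> E e)"
    proof (rule basic)
      show "open_pred n (\<lambda>e. \<not> E e)" unfolding E_def by (rule open_pred_not_cl) (rule "is")
    qed (intro dp_not dpE)
    have "definably_constructible M n (\<lambda>e. \<not> cl {..<n} X1 e)"
    proof (rule basic)
      show "open_pred n (\<lambda>e. \<not> cl {..<n} X1 e)" by (rule open_pred_not_cl) simp
      show "definable_pred M (\<lambda>e. \<not> cl {..<n} X1 e)"
        by (intro dp_not dp_cl[OF dp1 supp1]) simp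
    qed
    from inter[OF compl[OF this] nE] have c3: "definably_constructible M n (\<lambda>e. cl {..<n} X1 e \<and> \<not> E e)"
      by simp
    \<comment> \<open>Hence outside \<open>E\<close> the closure adds nothing to \<open>X1\<close>,
      and the third piece of the union is locally closed.\<close>
    have "E e" if "cl {..<n} X1 e" "\<not> X1 e" for e
      unfolding E_def by (rule cl_subset) (use that in \<open>auto simp: proj_def\<close>)
    then have "X = (\<lambda>e. (X e \<and> bad e) \<or> (X1 e \<and> E e) \<or> (cl {..<n} X1 e \<and> \<not> E e))"
      using cl_subset[of X1] unfolding X1_def by (auto simp: fun_eq_iff)
    then show ?thesis
      using definably_constructible_union[OF c2 definably_constructible_union[OF c1 c3]] by simp
  qed
qed

end

section \<open>The open core\<close>

text \<open>Points that agree below \<open>n\<close> are within every \<open>\<epsilon>\<close> of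
  each other.\<close>

lemma supported_open_pred:
  fixes P :: "(nat \<Rightarrow> 'a::linordered_field) \<Rightarrow> bool"
  shows "open_pred n P \<Longrightarrow> supported {..<n} P"
  unfolding supported_def
proof (intro allI impI)
  fix x y :: "nat \<Rightarrow> 'a" assume P: "open_pred n P" and xy: "\<forall>i\<in>{..<n}. x i = y i"
  have "near {..<n} \<epsilon> x y" "near {..<n} \<epsilon> y x" if "0 < \<epsilon>" for \<epsilon>
    using that xy by (auto simp: near_def)
  with P show "P x = P y" unfolding open_pred_def by blast
qed

lemma openin_open_pred:
  fixes P :: "(nat \<Rightarrow> 'a::{linordered_field, linorder_topology}) \<Rightarrow> bool"
  assumes "open_pred n P"
  shows "openin (power_topology n) {x \<in> {..<n} \<rightarrow>\<^sub>E UNIV. P x}"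
proof (subst openin_subopen, intro ballI)
  fix x assume x: "x \<in> {x \<in> {..<n} \<rightarrow>\<^sub>E UNIV. P x}"
  then obtain \<epsilon> where \<epsilon>: "0 < \<epsilon>" "\<And>y. near {..<n} \<epsilon> y x \<Longrightarrow> P y"
    using assms unfolding open_pred_def by blast
  let ?T = "PiE {..<n} (\<lambda>i. {x i - \<epsilon> <..< x i + \<epsilon>})"
  have "openin (power_topology n) ?T" by (subst openin_PiE) auto
  moreover have "x \<in> ?T" using x \<epsilon> by (auto simp: PiE_iff)
  moreover have "?T \<subseteq> {x \<in> {..<n} \<rightarrow>\<^sub>E UNIV. P x}"
  proof
    fix y assume y: "y \<in> ?T"
    have "near {..<n} \<epsilon> y x" unfolding near_def
    proof
      fix i assume "i \<in> {..<n}"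
      with y have "x i - \<epsilon> < y i" "y i < x i + \<epsilon>" by (auto simp: PiE_iff)
      then show "y i < x i + \<epsilon> \<and> x i < y i + \<epsilon>" by linarith
    qed
    with y \<epsilon>(2) show "y \<in> {x \<in> {..<n} \<rightarrow>\<^sub>E UNIV. P x}" by (auto simp: PiE_iff)
  qed
  ultimately show "\<exists>T. openin (power_topology n) T \<and> x \<in> T \<and> T \<subseteq> {x \<in> {..<n} \<rightarrow>\<^sub>E UNIV. P x}"
    by blast
qed

lemma constructible_in_definably_constructible:
  fixes M :: "('f, 'r, 'a::{linordered_field, linorder_topology}) fo_structure"
  assumes "definably_constructible M n P"
  shows "constructible_in (power_topology n) {x \<in> {..<n} \<rightarrow>\<^sub>E UNIV. P x}"
  using assms
proof induction
  case (basic P)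
  then show ?case by (intro constructible_open openin_open_pred)
next
  case (compl P)
  have "{x \<in> {..<n} \<rightarrow>\<^sub>E UNIV. \<not> P x} =
      topspace (power_topology n) - {x \<in> {..<n} \<rightarrow>\<^sub>E UNIV. P x}"
    by auto
  with constructible_compl[OF compl.IH] show ?case by simp
next
  case (inter P Q)
  have "{x \<in> {..<n} \<rightarrow>\<^sub>E UNIV. P x \<and> Q x} =
      {x \<in> {..<n} \<rightarrow>\<^sub>E UNIV. P x} \<inter> {x \<in> {..<n} \<rightarrow>\<^sub>E UNIV. Q x}"
    by auto
  with constructible_Int[OF inter.IH] show ?case by simp
qed

text \<open>A generator is itself a relation symbol of the open core, here applied to the variables
  below \<open>n\<close>.\<close>

lemma definable_pred_open_core:
  fixes M :: "('f, 'r, 'a::{linordered_field, linorder_topology}) fo_structure"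
  assumes "definably_constructible M n P"
  shows "definable_pred (open_core M) P"
  using assms
proof induction
  case (basic P)
  let ?U = "{x \<in> {..<n} \<rightarrow>\<^sub>E UNIV. P x}"
  have U: "restrict e {..<n} \<in> ?U \<longleftrightarrow> P e" for e :: "nat \<Rightarrow> 'a"
    using supportedD[OF supported_open_pred[OF basic(2)], of "restrict e {..<n}" e] by auto
  then have "definable M n ?U" unfolding definable_iff using basic(1) by auto
  moreover have "openin (power_topology n) ?U" using basic(2) by (rule openin_open_pred)
  ultimately have "wf_fm (open_core M) (Rel ?U (map Var [0..<n]))"
    by (simp add: open_core_def list_all_iff)
  then show ?case
  proof (rule definable_predI[where \<rho> = Inl])
    fix e :: "nat \<Rightarrow> 'a"
    have "(\<lambda>i\<in>{..<n}. map e [0..<n] ! i) = restrict e {..<n}" by (auto simp: fun_eq_iff)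
    then show "P e = sat (open_core M) (\<lambda>i. case_sum e id (Inl i)) (Rel ?U (map Var [0..<n]))"
      using U[of e] by (simp add: open_core_def comp_def)
  qed
qed (auto intro: dp_not dp_conj)

text \<open>Without function symbols every term is a variable, so a relational atom is a
  substitution instance of a set definable in \<open>M\<close>.\<close>

lemma definable_pred_sat_open_core:
  fixes M :: "('f, 'r, 'a::{linordered_field, linorder_topology}) fo_structure"
  shows "wf_fm (open_core M) \<phi> \<Longrightarrow> definable_pred M (\<lambda>e. sat (open_core M) e \<phi>)"
proof (induction \<phi>)
  have trm: "atomic (\<lambda>e. trm_val (open_core M) e t)" if "wf_trm (open_core M) t" for t
    using that by (cases t) (auto simp: open_core_def intro: atomic_var)
  {
    case (Eq s t)
    then show ?case by (auto intro!: dp_eq trm)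
  next
    case (Rel U ts)
    let ?n = "length ts"
    have "definable M ?n U" using Rel by (simp add: open_core_def)
    then have U: "definable_pred M (\<lambda>e. restrict e {..<?n} \<in> U)" by (simp add: definable_iff)
    \<comment> \<open>The filler \<open>e 0\<close> is removed by \<open>restrict\<close>.\<close>
    let ?g = "\<lambda>e i. if i < ?n then trm_val (open_core M) e (ts ! i) else e 0"
    have "atomic (\<lambda>e. ?g e i)" for i
      using Rel by (cases "i < ?n") (auto simp: list_all_iff intro: trm atomic_var)
    from dp_sub[OF U this] have "definable_pred M (\<lambda>e. restrict (?g e) {..<?n} \<in> U)" .
    moreover have "restrict (?g e) {..<?n} =
        (\<lambda>i\<in>{..<?n}. map (trm_val (open_core M) e) ts ! i)" for e
      by (auto simp: fun_eq_iff)
    ultimately show ?case by (simp add: open_core_def)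
  next
    case (Neg \<phi>)
    then show ?case by (auto intro: dp_not)
  next
    case (Conj \<phi> \<psi>)
    then show ?case by (auto intro: dp_conj)
  next
    case (Ex i \<phi>)
    then have IH: "definable_pred M (\<lambda>e. sat (open_core M) e \<phi>)" by simp
    show ?case by (simp, intro dp_ex dp_sub[OF IH] atomic_upd atomic_var)
  }
qed

theorem theorem6p8:
  fixes M :: "('f, 'r, 'a::{linordered_field, linorder_topology}) fo_structure"
  assumes "expands_ordered_field M"
    and "definably_complete M"
    and "locally_o_minimal M"
  shows "(\<forall>n A. definable M n A \<longrightarrow> constructible_in (power_topology n) A) \<and>
         (\<forall>n A. definable M n A \<longleftrightarrow> definable (open_core M) n A)"
proof -
  interpret definably_complete_lom M by unfold_locales (fact assms)+
  have dc: "definably_constructible M n (\<lambda>e. restrict e {..<n} \<in> A)" if "definable M n A" for n A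
  proof (rule definably_constructible)
    show "definable_pred M (\<lambda>e. restrict e {..<n} \<in> A)" using that by (simp add: definable_iff)
    have "restrict x {..<n} = restrict y {..<n}" if "\<forall>i\<in>{..<n}. x i = y i" for x y :: "nat \<Rightarrow> 'a"
      using that by (auto simp: fun_eq_iff)
    then show "supported {..<n} (\<lambda>e. restrict e {..<n} \<in> A)" unfolding supported_def by metis
  qed
  show ?thesis
  proof (intro conjI allI impI iffI)
    fix n A assume A: "definable M n A"
    then have sub: "A \<subseteq> {..<n} \<rightarrow>\<^sub>E UNIV" by (simp add: definable_iff)
    have "restrict x {..<n} = x" if "x \<in> {..<n} \<rightarrow>\<^sub>E UNIV" for x :: "nat \<Rightarrow> 'a"
      using that by (rule PiE_restrict)
    with sub have eq: "{x \<in> {..<n} \<rightarrow>\<^sub>E UNIV. restrict x {..<n} \<in> A} = A" by force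
    show "constructible_in (power_topology n) A"
      using constructible_in_definably_constructible[OF dc[OF A]] unfolding eq .
    show "definable (open_core M) n A"
      unfolding definable_iff using sub definable_pred_open_core[OF dc[OF A]] by simp
  next
    fix n A assume "definable (open_core M) n A"
    then obtain \<phi> p where 1: "wf_fm (open_core M) \<phi>"
      "A = {x \<in> {..<n} \<rightarrow>\<^sub>E UNIV. sat (open_core M) (\<lambda>i. if i < n then x i else p i) \<phi>}"
      unfolding definable_def by blast
    have "definable_pred M (\<lambda>e. sat (open_core M) (\<lambda>i. if i < n then e i else p i) \<phi>)"
      by (intro dp_sub[OF definable_pred_sat_open_core[OF 1(1)]] atomic_intros)
    moreover have "(\<lambda>i. if i < n then restrict e {..<n} i else p i) =
        (\<lambda>i. if i < n then e i else p i)" for e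
      by auto
    ultimately show "definable M n A" unfolding definable_iff 1(2) by auto
  qed
qed

end
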